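(* Let $\mathcal{L}$ be a real closed valued field with convex valuation and value group $\Gamma$, and let $A\in {\operatorname{\mathsf{TPD}}}_n(\mathbb{S}_{\max}^{\vee})$. Let ${\bf A}$ be a symmetric positive definite matrix over $\mathcal{L}$ such that $\mathrm{sv}({\bf A})= A$. Then, the signed valuations of the eigenvalues of ${\bf A}$, counted with multiplicities, coincide with the algebraic $\mathbb{S}_{\max}$-eigenvalues of $A$, that is the diagonal entries of $A$.
   Context: $\Gamma$ is a divisible totally ordered abelian group and $\mathbb{S}_{\max}=\mathbb{S}_{\max}(\Gamma)$ the symmetrized tropical semiring, with zero $\mathbf{0}$, unit $\mathbf{1}$, minus operator $\ominus$; $\mathbb{S}_{\max}^\vee$ (resp. $\mathbb{S}_{\max}^\oplus$) is the set of signed elements (resp. positive elements and $\mathbf{0}$), and $a\,\nabla\, b$ iff $a\ominus b$ is balanced; $a<b$ iff $b\ominus a\in\mathbb{S}_{\max}^\oplus\setminus\{\mathbf{0}\}$. $A\in{\operatorname{\mathsf{TPD}}}_n(\mathbb{S}_{\max}^\vee)$ means $A=(a_{ij})$ is symmetric with entries in $\mathbb{S}_{\max}^\vee$ and $\mathbf{0}<x^TAx$ for all nonzero $x\in(\mathbb{S}_{\max}^\vee)^n$ (equivalently $\mathbf{0}<a_{ii}$, $a_{ij}^2<a_{ii}a_{jj}$ for $i\ne j$). For an ordered field $\mathcal{L}$ with convex valuation $\mathrm v:\mathcal{L}\to\Gamma\cup\{\bot\}$, the signed valuation is $\mathrm{sv}(b)=\mathrm{sgn}(b)\odot\mathrm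 v(b)\in\mathbb{S}_{\max}^\vee$, where $\mathrm{sgn}(b)$ is $\mathbf{1}$, $\ominus\mathbf{1}$ or $\mathbf{0}$ according as $b>0$, $b<0$ or $b=0$; it is applied entrywise to matrices. The algebraic $\mathbb{S}_{\max}$-eigenvalues of $A$ are the $\gamma\in\mathbb{S}_{\max}^\vee$ with $\det(\gamma I\ominus A)\,\nabla\,\mathbf{0}$, counted with multiplicity as roots of the characteristic polynomial $\det(\mathsf{X} I\ominus A)$ (multiplicity $\mathrm{mult}_r(P)=1+\max\{\mathrm{mult}_r(Q): P\,\nabla\,(\mathsf{X}\ominus r)Q\}$ for a root $r$, $Q$ ranging over polynomials with signed coefficients). *)

theory Defs
  imports "Jordan_Normal_Form.Char_Poly" "HOL-Computational_Algebra.Polynomial"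
    "HOL-Combinatorics.Permutations"
begin

definition divisible_group :: "'g::linordered_ab_group_add itself \<Rightarrow> bool" where
  "divisible_group _ = (\<forall>(x::'g) (n::nat). n > 0 \<longrightarrow> (\<exists>y::'g. (\<Sum>i<n. y) = x))"

text \<open>SZero is the zero, SPos a is the positive element a (a in Gamma),
  SNeg a is the element minus a, SBal a is the balanced element a dot.\<close>
datatype 'g smax = SZero | SPos 'g | SNeg 'g | SBal 'g

fun smod :: "'g smax \<Rightarrow> 'g" where
  "smod SZero = undefined" | "smod (SPos a) = a" | "smod (SNeg a) = a" | "smod (SBal a) = a"

fun smax_add :: "'g::linorder smax \<Rightarrow> 'g smax \<Rightarrow> 'g smax" where
  "smax_add SZero y = y"
| "smax_add x SZero = x"
| "smax_add x y =
     (if smod y < smod x then x else if smod x < smod y then y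
      else if x = y then x else SBal (smod x))"

fun smax_mul :: "'g::ordered_ab_group_add smax \<Rightarrow> 'g smax \<Rightarrow> 'g smax" where
  "smax_mul SZero y = SZero"
| "smax_mul x SZero = SZero"
| "smax_mul (SPos a) (SPos b) = SPos (a + b)"
| "smax_mul (SPos a) (SNeg b) = SNeg (a + b)"
| "smax_mul (SNeg a) (SPos b) = SNeg (a + b)"
| "smax_mul (SNeg a) (SNeg b) = SPos (a + b)"
| "smax_mul x y = SBal (smod x + smod y)"

fun smax_neg :: "'g smax \<Rightarrow> 'g smax" where
  "smax_neg SZero = SZero" | "smax_neg (SPos a) = SNeg a"
| "smax_neg (SNeg a) = SPos a" | "smax_neg (SBal a) = SBal a"

instantiation smax :: (linordered_ab_group_add) comm_semiring_1
begin
definition "zero_smax = SZero"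
definition "one_smax = SPos 0"
definition "plus_smax = smax_add"
definition "times_smax = smax_mul"
instance
proof
  fix a b c :: "'a smax"
  show "a + b + c = a + (b + c)" unfolding plus_smax_def
    by (cases a; cases b; cases c) auto
  show "a + b = b + a" unfolding plus_smax_def
    by (cases a; cases b) auto
  show "0 + a = a" unfolding plus_smax_def zero_smax_def by simp
  show "a * b * c = a * (b * c)" unfolding times_smax_def
    by (cases a; cases b; cases c) (auto simp: add.assoc)
  show "a * b = b * a" unfolding times_smax_def
    by (cases a; cases b) (auto simp: add.commute)
  show "1 * a = a" unfolding times_smax_def one_smax_def by (cases a) auto
  show "0 * a = 0" unfolding times_smax_def zero_smax_def by simp
  show "a * 0 = 0" unfolding times_smax_def zero_smax_def by (cases a) auto
  show "(a + b) * c = a * c + b * c" unfolding times_smax_def plus_smax_def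
    by (cases a; cases b; cases c) auto
  show "(0::'a smax) \<noteq> 1" unfolding zero_smax_def one_smax_def by simp
qed
end

definition smax_balanced :: "'g smax \<Rightarrow> bool" where
  "smax_balanced x = (x = SZero \<or> (\<exists>a. x = SBal a))"

definition smax_signed :: "'g smax \<Rightarrow> bool" where
  "smax_signed x = (\<not> (\<exists>a. x = SBal a))"

definition smax_pos_or_zero :: "'g smax \<Rightarrow> bool" where
  "smax_pos_or_zero x = (x = SZero \<or> (\<exists>a. x = SPos a))"

definition smax_minus :: "'g::linordered_ab_group_add smax \<Rightarrow> 'g smax \<Rightarrow> 'g smax" where
  "smax_minus a b = a + smax_neg b"

definition smax_bal :: "'g::linordered_ab_group_add smax \<Rightarrow> 'g smax \<Rightarrow> bool" where
  "smax_bal a b = smax_balanced (smax_minus a b)"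

definition smax_less :: "'g::linordered_ab_group_add smax \<Rightarrow> 'g smax \<Rightarrow> bool" where
  "smax_less a b = (smax_pos_or_zero (smax_minus b a) \<and> smax_minus b a \<noteq> SZero)"

definition smax_TPD :: "nat \<Rightarrow> 'g::linordered_ab_group_add smax mat \<Rightarrow> bool" where
  "smax_TPD n A = (A \<in> carrier_mat n n \<and> A\<^sup>T = A \<and>
     (\<forall>i<n. \<forall>j<n. smax_signed (A $$ (i, j))) \<and>
     (\<forall>x::nat \<Rightarrow> 'g smax. (\<forall>i<n. smax_signed (x i)) \<and> (\<exists>i<n. x i \<noteq> 0) \<longrightarrow>
        smax_less 0 (\<Sum>i<n. \<Sum>j<n. x i * A $$ (i, j) * x j)))"

definition sym_det :: "('b::comm_semiring_1 \<Rightarrow> 'b) \<Rightarrow> nat \<Rightarrow> (nat \<Rightarrow> nat \<Rightarrow> 'b) \<Rightarrow> 'b" where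
  "sym_det ng n M = (\<Sum>p\<in>{p. p permutes {..<n}}.
      (if evenperm p then 1 else ng 1) * (\<Prod>i<n. M i (p i)))"

definition smax_poly_neg :: "'g::linordered_ab_group_add smax poly \<Rightarrow> 'g smax poly" where
  "smax_poly_neg P = map_poly smax_neg P"

definition smax_det_shift :: "'g::linordered_ab_group_add smax \<Rightarrow> 'g smax mat \<Rightarrow> 'g smax" where
  "smax_det_shift \<gamma> A = sym_det smax_neg (dim_row A)
     (\<lambda>i j. smax_minus (if i = j then \<gamma> else 0) (A $$ (i, j)))"

definition smax_char_poly :: "'g::linordered_ab_group_add smax mat \<Rightarrow> 'g smax poly" where
  "smax_char_poly A = sym_det smax_poly_neg (dim_row A)
     (\<lambda>i j. (if i = j then [:0, 1:] else 0) + [: smax_neg (A $$ (i, j)) :])"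

definition smax_poly_bal :: "'g::linordered_ab_group_add smax poly \<Rightarrow> 'g smax poly \<Rightarrow> bool" where
  "smax_poly_bal P R = (\<forall>k. smax_bal (coeff P k) (coeff R k))"

definition smax_poly_signed :: "'g::linordered_ab_group_add smax poly \<Rightarrow> bool" where
  "smax_poly_signed Q = (\<forall>k. smax_signed (coeff Q k))"

text \<open>mult_ge m P r: r has multiplicity at least m as a root of P, following the recursive
  definition mult_r(P) = 1 + max { mult_r(Q) : P balances (X minus r) Q, Q signed }.\<close>
primrec smax_mult_ge :: "nat \<Rightarrow> 'g::linordered_ab_group_add smax poly \<Rightarrow> 'g smax \<Rightarrow> bool" where
  "smax_mult_ge 0 P r = True"
| "smax_mult_ge (Suc m) P r = (\<exists>Q. smax_poly_signed Q \<and>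
      smax_poly_bal P ([: smax_neg r, 1 :] * Q) \<and> smax_mult_ge m Q r)"

definition smax_root_mult :: "'g::linordered_ab_group_add smax poly \<Rightarrow> 'g smax \<Rightarrow> nat" where
  "smax_root_mult P r = (GREATEST m. smax_mult_ge m P r)"

definition smax_alg_eig_mult :: "'g::linordered_ab_group_add smax mat \<Rightarrow> 'g smax \<Rightarrow> nat" where
  "smax_alg_eig_mult A \<gamma> =
     (if smax_signed \<gamma> \<and> smax_bal (smax_det_shift \<gamma> A) 0
      then smax_root_mult (smax_char_poly A) \<gamma> else 0)"

definition real_closed_field :: "'a::linordered_field itself \<Rightarrow> bool" where
  "real_closed_field _ = ((\<forall>x::'a. 0 \<le> x \<longrightarrow> (\<exists>y. y * y = x)) \<and>
     (\<forall>p::'a poly. odd (degree p) \<longrightarrow> (\<exists>x. poly p x = 0)))"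

text \<open>A (max-plus convention) valuation v : L -> Gamma union {bot}, None standing for bot,
  which is convex and has value group Gamma (surjective onto Gamma).\<close>
definition convex_valuation :: "('a::linordered_field \<Rightarrow> 'g::linordered_ab_group_add option) \<Rightarrow> bool" where
  "convex_valuation v =
    ((\<forall>x. v x = None \<longleftrightarrow> x = 0) \<and>
     (\<forall>x y. x \<noteq> 0 \<longrightarrow> y \<noteq> 0 \<longrightarrow> v (x * y) = Some (the (v x) + the (v y))) \<and>
     (\<forall>x y. x + y \<noteq> 0 \<longrightarrow> x \<noteq> 0 \<longrightarrow> y \<noteq> 0 \<longrightarrow>
        the (v (x + y)) \<le> max (the (v x)) (the (v y))) \<and>
     (\<forall>x y. x \<noteq> 0 \<longrightarrow> \<bar>x\<bar> \<le> \<bar>y\<bar> \<longrightarrow> the (v x) \<le> the (v y)) \<and>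
     (\<forall>g. \<exists>x. v x = Some g))"

definition signed_val :: "('a::linordered_field \<Rightarrow> 'g option) \<Rightarrow> 'a \<Rightarrow> 'g smax" where
  "signed_val v b = (if b > 0 then SPos (the (v b)) else if b < 0 then SNeg (the (v b)) else SZero)"

definition pos_def_mat :: "nat \<Rightarrow> 'a::linordered_field mat \<Rightarrow> bool" where
  "pos_def_mat n A = (A \<in> carrier_mat n n \<and> A\<^sup>T = A \<and>
     (\<forall>x \<in> carrier_vec n. x \<noteq> 0\<^sub>v n \<longrightarrow> 0 < x \<bullet> (A *\<^sub>v x)))"

end

theory Submission
  imports Defs "HOL-Algebra.Algebraic_Closure_Type" "HOL-Computational_Algebra.Polynomial_FPS"
    "HOL-Library.Option_ord"
begin

text \<open>
  Tropical positive definiteness, evaluated at the vector with the two entries \<open>a\<^sub>j\<^sub>j\<close> and \<open>\<ominus>a\<^sub>i\<^sub>j\<close>,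
  forces \<open>a\<^sub>i\<^sub>j\<^sup>2 < a\<^sub>i\<^sub>i a\<^sub>j\<^sub>j\<close>, so in the tropical characteristic polynomial every permutation other than
  the identity is absorbed and the polynomial is the product of the \<open>X \<ominus> a\<^sub>i\<^sub>i\<close>. Edges of Newton polygons
  add up under multiplication of polynomials, and a balance \<open>P \<nabla> R\<close> with \<open>P\<close> signed preserves those
  ending in signed coefficients. Hence the multiplicity of \<open>\<gamma>\<close> as a root is at most the width of the
  edge of slope \<open>\<gamma>\<close>, which for a product of factors \<open>X \<ominus> d\<close> with \<open>d\<close> positive is the number of \<open>d\<close>
  equal to \<open>\<gamma>\<close>. In particular such a product determines its factors.

  Over the real closed field the characteristic polynomial of a symmetric matrix splits, by
  Laplace's proof of the fundamental theorem of algebra inside the algebraic closure, and positive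
  definiteness makes its roots \<open>\<lambda>\<close> positive. The coefficients of the product of the \<open>X - \<lambda>\<close> and of the
  characteristic polynomial computed from the entries therefore have as signed valuations the
  coefficients of the products of the \<open>X \<ominus> sv \<lambda>\<close> and of the \<open>X \<ominus> a\<^sub>i\<^sub>i\<close>, no cancellation being
  possible. These two products are equal, hence so are their factors.
\<close>

hide_const (open) Polynomials.degree Polynomials.lead_coeff Module.smult UnivPoly.coeff UnivPoly.monom

section \<open>Modulus, sign and balance in the symmetrized tropical semiring\<close>

lemmas smax_ops = plus_smax_def times_smax_def zero_smax_def one_smax_def

text \<open>In the order on \<open>option\<close>, the modulus \<open>None\<close> of zero is the least element, as for valuations.\<close>
fun modulus :: "'g smax \<Rightarrow> 'g option" where
  "modulus SZero = None"
| "modulus (SPos a) = Some a"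
| "modulus (SNeg a) = Some a"
| "modulus (SBal a) = Some a"

context
  fixes x y z u :: "'g::linordered_ab_group_add smax"
begin

lemma modulus_0 [simp]: "modulus (0 :: 'g smax) = None"
  by (simp add: smax_ops)

lemma modulus_1 [simp]: "modulus (1 :: 'g smax) = Some 0"
  by (simp add: smax_ops)

lemma modulus_eq_None_iff [simp]: "modulus x = None \<longleftrightarrow> x = 0"
  by (cases x) (auto simp: smax_ops)

lemma None_less_modulus_iff [simp]: "None < modulus x \<longleftrightarrow> x \<noteq> 0"
  by (cases x) (auto simp: smax_ops)

lemma modulus_neg [simp]: "modulus (smax_neg x) = modulus x"
  by (cases x) auto

lemma modulus_add: "modulus (x + y) = max (modulus x) (modulus y)"
  by (cases x; cases y) (auto simp: smax_ops max_def)

lemma modulus_mult_mono: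
  "modulus x \<le> modulus z \<Longrightarrow> modulus y \<le> modulus u \<Longrightarrow> modulus (x * y) \<le> modulus (z * u)"
  by (cases x; cases y; cases z; cases u) (auto simp: smax_ops intro: add_mono)

lemma modulus_mult_strict_mono:
  "modulus x < modulus z \<Longrightarrow> modulus y \<le> modulus u \<Longrightarrow> u \<noteq> 0 \<Longrightarrow> modulus (x * y) < modulus (z * u)"
  by (cases x; cases y; cases z; cases u) (auto simp: smax_ops intro: add_less_le_mono)

lemma SPos_add: "SPos a + SPos b = SPos (max a b :: 'g)"
  by (auto simp: smax_ops max_def)

lemma add_absorb: "modulus y < modulus x \<Longrightarrow> x + y = x"
  by (cases x; cases y) (auto simp: smax_ops)

lemma smax_mult_eq_0_iff [simp]: "x * y = 0 \<longleftrightarrow> x = 0 \<or> y = 0"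
  by (cases x; cases y) (auto simp: smax_ops)

lemma smax_neg_eq_0_iff [simp]: "smax_neg x = 0 \<longleftrightarrow> x = 0"
  by (cases x) (auto simp: smax_ops)

lemma smax_neg_0 [simp]: "smax_neg (0 :: 'g smax) = 0"
  by (simp add: smax_ops)

lemma smax_neg_eq_mult: "smax_neg x = smax_neg 1 * x"
  by (cases x) (auto simp: smax_ops)

lemma smax_mult_neg: "x * smax_neg y = smax_neg (x * y)"
  by (cases x; cases y) (auto simp: smax_ops)

lemma smax_neg_mult_neg [simp]: "smax_neg x * smax_neg y = x * y"
  by (cases x; cases y) (auto simp: smax_ops)

lemma smax_less_0_iff: "smax_less 0 x \<longleftrightarrow> (\<exists>g. x = SPos g)"
  by (cases x) (auto simp: smax_less_def smax_minus_def smax_pos_or_zero_def smax_ops)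

lemma smax_signed_if_less_0: "smax_less 0 x \<Longrightarrow> smax_signed x"
  by (auto simp: smax_less_0_iff smax_signed_def)

lemma smax_signed_0: "smax_signed (0 :: 'g smax)" and smax_signed_1: "smax_signed (1 :: 'g smax)"
  by (auto simp: smax_signed_def smax_ops)

lemma smax_signed_neg: "smax_signed x \<Longrightarrow> smax_signed (smax_neg x)"
  by (cases x) (auto simp: smax_signed_def)

lemma smax_signed_mult: "smax_signed x \<Longrightarrow> smax_signed y \<Longrightarrow> smax_signed (x * y)"
  by (cases x; cases y) (auto simp: smax_signed_def smax_ops)

lemma smax_balanced_mult: "smax_balanced (x * y) \<longleftrightarrow> smax_balanced x \<or> smax_balanced y"
  by (cases x; cases y) (auto simp: smax_balanced_def smax_ops)

lemma smax_bal_refl: "smax_bal x x"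
  by (cases x) (auto simp: smax_bal_def smax_minus_def smax_balanced_def smax_ops)

lemma smax_bal_0_iff: "smax_bal x 0 \<longleftrightarrow> smax_balanced x"
  by (simp add: smax_bal_def smax_minus_def)

lemma smax_bal_signed_imp_eq: "smax_signed x \<Longrightarrow> smax_signed y \<Longrightarrow> smax_bal x y \<Longrightarrow> x = y"
  by (cases x; cases y)
    (auto simp: smax_bal_def smax_minus_def smax_balanced_def smax_signed_def smax_ops split: if_splits)

lemma modulus_le_if_smax_bal: "smax_signed x \<Longrightarrow> smax_bal x y \<Longrightarrow> modulus x \<le> modulus y"
  by (cases x; cases y)
    (auto simp: smax_bal_def smax_minus_def smax_balanced_def smax_signed_def smax_ops split: if_splits)

end

lemma modulus_square_less_imp:
  fixes x y :: "'g::linordered_ab_group_add smax"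
  shows "modulus (x * x) < modulus (y * y) \<Longrightarrow> modulus x < modulus y"
  using modulus_mult_mono[of y x y x] by (meson not_le)

lemma smax_bal_mult_left:
  fixes x y z :: "'g::linordered_ab_group_add smax"
  assumes "smax_bal x y"
  shows "smax_bal (z * x) (z * y)"
proof -
  have "smax_minus (z * x) (z * y) = z * smax_minus x y"
    by (simp add: smax_minus_def smax_mult_neg distrib_left)
  then show ?thesis
    using assms by (simp add: smax_bal_def smax_balanced_mult)
qed

lemma smax_signed_power:
  "smax_signed x \<Longrightarrow> smax_signed (x ^ k :: 'g::linordered_ab_group_add smax)"
  by (induction k) (auto intro: smax_signed_mult smax_signed_1)

lemma smax_power_eq_0_iff [simp]: "(x :: 'g::linordered_ab_group_add smax) ^ k = 0 \<longleftrightarrow> k > 0 \<and> x = 0"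
  by (induction k) auto

lemma modulus_le_sum:
  fixes f :: "'i \<Rightarrow> 'g::linordered_ab_group_add smax"
  assumes "finite S" "i \<in> S"
  shows "modulus (f i) \<le> modulus (sum f S)"
  using sum.remove[OF assms, of f] by (simp add: modulus_add)

lemma modulus_sum_le:
  fixes f :: "'i \<Rightarrow> 'g::linordered_ab_group_add smax"
  assumes "\<And>i. i \<in> S \<Longrightarrow> modulus (f i) \<le> b"
  shows "modulus (sum f S) \<le> b"
  using assms by (induction S rule: infinite_finite_induct) (auto simp: modulus_add)

lemma modulus_sum_less:
  fixes f :: "'i \<Rightarrow> 'g::linordered_ab_group_add smax"
  assumes "None < b" "\<And>i. i \<in> S \<Longrightarrow> modulus (f i) < b"
  shows "modulus (sum f S) < b"
  using assms by (induction S rule: infinite_finite_induct) (auto simp: modulus_add)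

lemma modulus_prod_strict_mono:
  fixes f h :: "'i \<Rightarrow> 'g::linordered_ab_group_add smax"
  assumes "finite S" "S \<noteq> {}" "\<And>i. i \<in> S \<Longrightarrow> modulus (f i) < modulus (h i)"
  shows "modulus (prod f S) < modulus (prod h S)"
  using assms
proof (induction S rule: finite_ne_induct)
  case (insert i S)
  then have "modulus (prod f S) < modulus (prod h S)" by simp
  then have "modulus (f i * prod f S) < modulus (h i * prod h S)"
    using insert.prems[of i] by (intro modulus_mult_strict_mono) auto
  with insert.hyps show ?case by simp
qed simp

lemma sum_absorb:
  assumes "finite S" "\<And>s. s \<in> S \<Longrightarrow> a + f s = (a :: 'a::comm_monoid_add)"
  shows "a + sum f S = a"
  using assms by (induction S rule: finite_induct) (auto simp: add.assoc[symmetric])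

section \<open>The characteristic polynomial of a diagonally dominant matrix\<close>

text \<open>Multiplying \<open>\<bar>b\<^sub>i\<^sub>,\<^sub>p\<^sub>i\<bar>\<^sup>2 < \<bar>b\<^sub>i\<^sub>,\<^sub>i b\<^sub>p\<^sub>i\<^sub>,\<^sub>p\<^sub>i\<bar>\<close> over the moved points yields the square of every diagonal
  entry involved.\<close>
lemma modulus_permuted_prod_less:
  fixes B :: "'i \<Rightarrow> 'i \<Rightarrow> 'g::linordered_ab_group_add smax"
  assumes "finite S" and p: "p permutes S" "p \<noteq> id"
    and dom: "\<And>i j. i \<in> S \<Longrightarrow> j \<in> S \<Longrightarrow> i \<noteq> j \<Longrightarrow> modulus (B i j * B i j) < modulus (B i i * B j j)"
  defines "G \<equiv> {i. p i \<noteq> i}"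
  shows "modulus (\<Prod>i\<in>G. B i (p i)) < modulus (\<Prod>i\<in>G. B i i)"
proof (rule modulus_square_less_imp)
  have "G \<subseteq> S" using permutes_not_in[OF p(1)] by (auto simp: G_def)
  then have fin: "finite G" using \<open>finite S\<close> finite_subset by blast
  have pG: "p permutes G" using p(1) by (rule permutes_superset) (simp add: G_def)
  have "G \<noteq> {}" using p(2) by (auto simp: G_def)
  have "modulus (\<Prod>i\<in>G. B i (p i) * B i (p i)) < modulus (\<Prod>i\<in>G. B i i * B (p i) (p i))"
  proof (rule modulus_prod_strict_mono[OF fin \<open>G \<noteq> {}\<close>])
    fix i assume "i \<in> G"
    then show "modulus (B i (p i) * B i (p i)) < modulus (B i i * B (p i) (p i))"
      using \<open>G \<subseteq> S\<close> permutes_in_image[OF p(1), of i] by (intro dom) (auto simp: G_def)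
  qed
  also have "(\<Prod>i\<in>G. B (p i) (p i)) = (\<Prod>i\<in>G. B i i)"
    using prod.permute[OF pG, of "\<lambda>i. B i i"] by (simp add: comp_def)
  then have "(\<Prod>i\<in>G. B i i * B (p i) (p i)) = (\<Prod>i\<in>G. B i i) * (\<Prod>i\<in>G. B i i)"
    by (simp add: prod.distrib)
  finally show "modulus ((\<Prod>i\<in>G. B i (p i)) * (\<Prod>i\<in>G. B i (p i)))
      < modulus ((\<Prod>i\<in>G. B i i) * (\<Prod>i\<in>G. B i i))"
    by (simp add: prod.distrib)
qed

lemma smax_poly_absorb_smult:
  fixes P Q :: "'g::linordered_ab_group_add smax poly"
  assumes "modulus c < modulus (coeff Q 0)"
  shows "P * Q + smult c P = P * Q"
proof (rule poly_eqI)
  fix k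
  show "coeff (P * Q + smult c P) k = coeff (P * Q) k"
  proof (cases "coeff P k = 0")
    case False
    have "modulus (c * coeff P k) < modulus (coeff Q 0 * coeff P k)"
      using assms False by (intro modulus_mult_strict_mono) auto
    also have "\<dots> \<le> modulus (coeff (P * Q) k)"
      unfolding coeff_mult using modulus_le_sum[of "{..k}" k "\<lambda>i. coeff P i * coeff Q (k - i)"]
      by (simp add: mult.commute)
    finally show ?thesis by (simp add: add_absorb)
  qed simp
qed

lemma prod_linear_absorbs_permuted_prod:
  fixes B :: "nat \<Rightarrow> nat \<Rightarrow> 'g::linordered_ab_group_add smax"
  assumes p: "p permutes {..<n}" "p \<noteq> id"
    and dom: "\<And>i j. i < n \<Longrightarrow> j < n \<Longrightarrow> i \<noteq> j \<Longrightarrow> modulus (B i j * B i j) < modulus (B i i * B j j)"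
    and s: "modulus s = Some 0"
  shows "(\<Prod>i<n. [:B i i, 1:]) + [:s:] * (\<Prod>i<n. (if i = p i then [:0, 1:] else 0) + [:B i (p i):])
    = (\<Prod>i<n. [:B i i, 1:])"
proof -
  define G F where "G = {i. p i \<noteq> i}" and "F = {i. i < n \<and> p i = i}"
  have "{..<n} = F \<union> G" using permutes_not_in[OF p(1)] by (auto simp: F_def G_def)
  moreover have "F \<inter> G = {}" by (auto simp: F_def G_def)
  ultimately have split: "prod f {..<n} = prod f F * prod f G" for f :: "nat \<Rightarrow> 'g smax poly"
    by (metis finite_Un finite_lessThan prod.union_disjoint)
  define P c where "P = (\<Prod>i\<in>F. [:B i i, 1:])" and "c = s * (\<Prod>i\<in>G. B i (p i))"
  have "(\<Prod>i\<in>F. (if i = p i then [:0, 1:] else 0) + [:B i (p i):]) = P"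
    unfolding P_def by (intro prod.cong) (auto simp: F_def)
  moreover have "(\<Prod>i\<in>G. (if i = p i then [:0, 1:] else 0) + [:B i (p i):]) = (\<Prod>i\<in>G. [:B i (p i):])"
    by (intro prod.cong) (auto simp: G_def)
  then have "(\<Prod>i\<in>G. (if i = p i then [:0, 1:] else 0) + [:B i (p i):]) = [:\<Prod>i\<in>G. B i (p i):]"
    by (simp add: prod_unfold_prod_mset prod_mset_const_poly)
  ultimately have permuted:
    "[:s:] * (\<Prod>i<n. (if i = p i then [:0, 1:] else 0) + [:B i (p i):]) = smult c P"
    unfolding split by (simp add: c_def mult.commute)
  have "modulus c < modulus (coeff (\<Prod>i\<in>G. [:B i i, 1:]) 0)"
  proof -
    have "modulus (\<Prod>i\<in>G. B i (p i)) < modulus (\<Prod>i\<in>G. B i i)"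
      using modulus_permuted_prod_less[OF finite_lessThan p, of B] dom by (simp add: G_def)
    then have "modulus ((\<Prod>i\<in>G. B i (p i)) * s) < modulus ((\<Prod>i\<in>G. B i i) * 1)"
      using s by (intro modulus_mult_strict_mono) simp_all
    then show ?thesis by (simp add: c_def mult.commute poly_prod flip: poly_0_coeff_0)
  qed
  then show ?thesis
    unfolding permuted split[of "\<lambda>i. [:B i i, 1:]"] P_def[symmetric] by (rule smax_poly_absorb_smult)
qed

theorem smax_char_poly_diag_dominant:
  fixes A :: "'g::linordered_ab_group_add smax mat"
  assumes A: "A \<in> carrier_mat n n"
    and dom: "\<And>i j. i < n \<Longrightarrow> j < n \<Longrightarrow> i \<noteq> j \<Longrightarrow>
      modulus (A $$ (i, j) * A $$ (i, j)) < modulus (A $$ (i, i) * A $$ (j, j))"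
  shows "smax_char_poly A = (\<Prod>i<n. [:smax_neg (A $$ (i, i)), 1:])"
proof -
  define B where "B i j = smax_neg (A $$ (i, j))" for i j
  define T where "T p = (if evenperm p then 1 else smax_poly_neg 1) *
      (\<Prod>i<n. (if i = p i then [:0, 1:] else 0) + [:B i (p i):])" for p
  have sgn: "(if evenperm p then 1 else smax_poly_neg 1)
      = [:if evenperm p then 1 else smax_neg 1 :: 'g smax:]" for p :: "nat \<Rightarrow> nat"
    by (simp add: smax_poly_neg_def one_pCons)
  have "smax_char_poly A = (\<Sum>p\<in>{p. p permutes {..<n}}. T p)"
    using A by (simp add: smax_char_poly_def sym_det_def T_def B_def)
  also have "\<dots> = T id + (\<Sum>p\<in>{p. p permutes {..<n}} - {id}. T p)"
    by (intro sum.remove) (auto simp: finite_permutations permutes_id)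
  also have "\<dots> = T id"
  proof (rule sum_absorb)
    fix p assume "p \<in> {p. p permutes {..<n}} - {id}"
    then show "T id + T p = T id"
      unfolding T_def[of p] sgn
      using prod_linear_absorbs_permuted_prod[of p n B] dom by (simp add: T_def B_def)
  qed (simp add: finite_permutations)
  finally show ?thesis by (simp add: T_def B_def)
qed

lemma smax_det_shift_eq_poly: "smax_det_shift \<gamma> A = poly (smax_char_poly A) \<gamma>"
proof -
  have "poly (smax_poly_neg 1) \<gamma> = smax_neg 1"
    by (simp add: smax_poly_neg_def one_pCons)
  then show ?thesis
    by (auto simp: smax_det_shift_def smax_char_poly_def sym_det_def poly_sum poly_prod smax_minus_def
      intro!: sum.cong prod.cong arg_cong2[of _ _ _ _ "(*)"])
qed

section \<open>Tropical positive definiteness\<close>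

lemma smax_TPD_quadratic_form_pos:
  fixes A :: "'g::linordered_ab_group_add smax mat"
  assumes tpd: "smax_TPD n A" and S: "S \<subseteq> {..<n}"
    and x: "\<And>i. i \<in> S \<Longrightarrow> smax_signed (x i)" "\<exists>i\<in>S. x i \<noteq> 0"
  shows "smax_less 0 (\<Sum>i\<in>S. \<Sum>j\<in>S. x i * A $$ (i, j) * x j)"
proof -
  have "finite S" using S finite_subset by blast
  define x' where "x' i = (if i \<in> S then x i else 0)" for i
  have "(\<Sum>j<n. x' i * A $$ (i, j) * x' j) = (\<Sum>j\<in>S. x' i * A $$ (i, j) * x j)" for i
    using S by (intro sum.mono_neutral_cong_right) (auto simp: x'_def)
  then have "(\<Sum>i<n. \<Sum>j<n. x' i * A $$ (i, j) * x' j) = (\<Sum>i\<in>S. \<Sum>j\<in>S. x i * A $$ (i, j) * x j)"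
    using S \<open>finite S\<close> by (simp only:) (intro sum.mono_neutral_cong_right, auto simp: x'_def)
  moreover have "\<forall>i<n. smax_signed (x' i)" "\<exists>i<n. x' i \<noteq> 0"
    using x S by (auto simp: x'_def smax_signed_0)
  then have "smax_less 0 (\<Sum>i<n. \<Sum>j<n. x' i * A $$ (i, j) * x' j)"
    using tpd unfolding smax_TPD_def by blast
  ultimately show ?thesis by simp
qed

lemma smax_TPD_diag_pos:
  assumes "smax_TPD n A" "i < n"
  shows "smax_less 0 (A $$ (i, i))"
  using smax_TPD_quadratic_form_pos[OF assms(1), of "{i}" "\<lambda>_. 1"] assms(2) by (simp add: smax_signed_1)

lemma smax_TPD_off_diag_less:
  fixes A :: "'g::linordered_ab_group_add smax mat"
  assumes tpd: "smax_TPD n A" and ij: "i < n" "j < n" "i \<noteq> j"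
  shows "modulus (A $$ (i, j) * A $$ (i, j)) < modulus (A $$ (i, i) * A $$ (j, j))"
proof -
  have A: "A \<in> carrier_mat n n" "A\<^sup>T = A" and signed: "smax_signed (A $$ (i, j))"
    using tpd ij by (auto simp: smax_TPD_def)
  then have sym: "A $$ (j, i) = A $$ (i, j)"
    using ij by (metis carrier_matD index_transpose_mat(1))
  obtain a b where ab: "A $$ (i, i) = SPos a" "A $$ (j, j) = SPos b"
    using smax_TPD_diag_pos[OF tpd] ij(1,2) unfolding smax_less_0_iff by blast
  define x where "x k = (if k = i then A $$ (j, j) else smax_neg (A $$ (i, j)))" for k
  have "smax_less 0 (\<Sum>k\<in>{i, j}. \<Sum>l\<in>{i, j}. x k * A $$ (k, l) * x l)"
    using ij ab signed
    by (intro smax_TPD_quadratic_form_pos[OF tpd])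
      (auto simp: x_def smax_signed_neg, auto simp: smax_signed_def smax_ops)
  then have "smax_less 0 (A $$ (j, j) * A $$ (i, i) * A $$ (j, j)
      + A $$ (j, j) * (A $$ (i, j) * smax_neg (A $$ (i, j)))
      + (A $$ (j, j) * (A $$ (i, j) * smax_neg (A $$ (i, j))) + A $$ (j, j) * (A $$ (i, j) * A $$ (i, j))))"
    using ij sym by (simp add: x_def mult_ac)
  then show ?thesis
    using signed unfolding ab smax_less_0_iff
    by (cases "A $$ (i, j)") (auto simp: smax_signed_def smax_ops add_ac split: if_splits)
qed

section \<open>Multiplicities of tropical roots\<close>

text \<open>The edge of slope zero of the Newton polygon of \<open>P\<close>, required to end in signed coefficients.\<close>
definition flat_edge :: "'g::linordered_ab_group_add smax poly \<Rightarrow> nat \<Rightarrow> nat \<Rightarrow> bool" where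
  "flat_edge P i j \<longleftrightarrow> coeff P i \<noteq> 0 \<and> modulus (coeff P j) = modulus (coeff P i) \<and>
     smax_signed (coeff P i) \<and> smax_signed (coeff P j) \<and>
     (\<forall>k. modulus (coeff P k) \<le> modulus (coeff P i)) \<and>
     (\<forall>k. k < i \<or> j < k \<longrightarrow> modulus (coeff P k) < modulus (coeff P i))"

lemma flat_edge_le: "flat_edge P i j \<Longrightarrow> i \<le> j"
  unfolding flat_edge_def by (metis leI less_irrefl)

lemma flat_edge_unique:
  assumes "flat_edge P i j" "flat_edge P i' j'"
  shows "i = i' \<and> j = j'"
  using assms unfolding flat_edge_def by (metis leD linorder_neqE_nat)

lemma flat_edge_exists:
  fixes P :: "'g::linordered_ab_group_add smax poly"
  assumes "P \<noteq> 0" "smax_poly_signed P"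
  obtains i j where "flat_edge P i j"
proof -
  define m where "m = Max (range (\<lambda>k. modulus (coeff P k)))"
  define I where "I = {k. modulus (coeff P k) = m}"
  have fin: "finite (range (\<lambda>k. modulus (coeff P k)))"
  proof (rule finite_subset)
    show "range (\<lambda>k. modulus (coeff P k)) \<subseteq> insert None ((\<lambda>k. modulus (coeff P k)) ` {..degree P})"
      by (auto simp: image_iff) (metis atMost_iff le_degree)
  qed simp
  then have le: "modulus (coeff P k) \<le> m" for k
    unfolding m_def by (intro Max_ge) auto
  have "None < m"
    using less_le_trans[OF _ le[of "degree P"]] assms(1) by simp
  then have "I \<subseteq> {..degree P}"
    by (auto simp: I_def intro!: le_degree)
  then have "finite I" by (rule finite_subset) simp
  moreover have "I \<noteq> {}"
    using Max_in[OF fin] by (auto simp: I_def m_def)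
  ultimately have "Min I \<in> I" "Max I \<in> I" by simp_all
  then have ends: "modulus (coeff P (Min I)) = m" "modulus (coeff P (Max I)) = m"
    by (simp_all add: I_def)
  have "modulus (coeff P k) < m" if "k < Min I \<or> Max I < k" for k
  proof -
    have "k \<notin> I" using that Min_le[OF \<open>finite I\<close>] Max_ge[OF \<open>finite I\<close>] by (meson leD)
    then show ?thesis using le[of k] by (simp add: I_def less_le)
  qed
  moreover have "coeff P (Min I) \<noteq> 0"
    using ends(1) \<open>None < m\<close> by (metis None_less_modulus_iff)
  ultimately have "flat_edge P (Min I) (Max I)"
    using le assms(2) by (simp add: flat_edge_def ends smax_poly_signed_def)
  then show thesis by (rule that)
qed

lemma coeff_mult_dominant:
  fixes P Q :: "'g::linordered_ab_group_add smax poly"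
  assumes "\<And>i' j'. i' + j' = i + j \<Longrightarrow> i' \<noteq> i \<Longrightarrow>
    modulus (coeff P i' * coeff Q j') < modulus (coeff P i * coeff Q j)"
  shows "coeff (P * Q) (i + j) = coeff P i * coeff Q j"
proof -
  have "coeff (P * Q) (i + j) = coeff P i * coeff Q j +
      (\<Sum>k\<in>{..i + j} - {i}. coeff P k * coeff Q (i + j - k))"
    unfolding coeff_mult by (subst sum.remove[of _ i]) auto
  also have "\<dots> = coeff P i * coeff Q j"
    using assms by (intro sum_absorb add_absorb) auto
  finally show ?thesis .
qed

lemma flat_edge_mult:
  fixes P Q :: "'g::linordered_ab_group_add smax poly"
  assumes P: "flat_edge P i j" and Q: "flat_edge Q k l"
  shows "flat_edge (P * Q) (i + k) (j + l)"
proof -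
  define m where "m = modulus (coeff P i * coeff Q k)"
  have le: "modulus (coeff P r * coeff Q s) \<le> m" for r s
    using P Q unfolding m_def flat_edge_def by (blast intro: modulus_mult_mono)
  have outside: "modulus (coeff P r * coeff Q s) < m" if "r < i \<or> j < r \<or> s < k \<or> l < s" for r s
    using that modulus_mult_strict_mono[of "coeff P r" "coeff P i" "coeff Q s" "coeff Q k"]
      modulus_mult_strict_mono[of "coeff Q s" "coeff Q k" "coeff P r" "coeff P i"] P Q
    unfolding m_def flat_edge_def by (metis mult.commute)
  have right_end: "modulus (coeff P j * coeff Q l) = m"
    using P Q unfolding m_def flat_edge_def by (metis modulus_mult_mono order.eq_iff)
  have ends: "coeff (P * Q) (i + k) = coeff P i * coeff Q k"
    "coeff (P * Q) (j + l) = coeff P j * coeff Q l"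
    by (rule coeff_mult_dominant, unfold right_end m_def[symmetric], rule outside, linarith)+
  have "None < m" using outside[of "Suc j"] by (cases m) auto
  have "modulus (coeff (P * Q) n) \<le> m" for n
    unfolding coeff_mult by (intro modulus_sum_le le)
  moreover have "modulus (coeff (P * Q) n) < m" if "n < i + k \<or> j + l < n" for n
    unfolding coeff_mult using that \<open>None < m\<close> by (intro modulus_sum_less outside) auto
  ultimately show ?thesis
    using P Q right_end unfolding flat_edge_def ends m_def
    by (auto intro: smax_signed_mult)
qed

lemma flat_edge_if_smax_poly_bal:
  assumes P: "smax_poly_signed P" "smax_poly_bal P R" and R: "flat_edge R i j"
  shows "flat_edge P i j"
proof -
  have "coeff P i = coeff R i" "coeff P j = coeff R j"
    using P R smax_bal_signed_imp_eq
    unfolding smax_poly_signed_def smax_poly_bal_def flat_edge_def by blast+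
  moreover have "modulus (coeff P k) \<le> modulus (coeff R k)" for k
    using P modulus_le_if_smax_bal unfolding smax_poly_signed_def smax_poly_bal_def by blast
  ultimately show ?thesis
    using R unfolding flat_edge_def by (metis order.trans le_less_trans)
qed

text \<open>Substituting \<open>g X\<close> for \<open>X\<close> flattens the edge of slope \<open>g\<close>.\<close>
definition rescale :: "'g::linordered_ab_group_add \<Rightarrow> 'g smax poly \<Rightarrow> 'g smax poly" where
  "rescale g P = P \<circ>\<^sub>p [:0, SPos g:]"

lemma coeff_rescale: "coeff (rescale g P) k = SPos g ^ k * coeff P k"
  by (simp add: rescale_def coeff_pcompose_linear)

lemma rescale_eq_0_iff: "rescale g P = 0 \<longleftrightarrow> P = 0"
  by (auto simp: poly_eq_iff coeff_rescale) (simp add: zero_smax_def)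

lemma smax_poly_signed_rescale: "smax_poly_signed P \<Longrightarrow> smax_poly_signed (rescale g P)"
  unfolding smax_poly_signed_def coeff_rescale
  by (intro allI smax_signed_mult smax_signed_power) (auto simp: smax_signed_def)

lemma smax_poly_bal_rescale: "smax_poly_bal P R \<Longrightarrow> smax_poly_bal (rescale g P) (rescale g R)"
  by (simp add: smax_poly_bal_def coeff_rescale smax_bal_mult_left)

lemma flat_edge_rescale_linear:
  assumes "smax_signed d"
  shows "flat_edge (rescale g [:smax_neg d, 1:])
    (if modulus d < Some g then 1 else 0) (if modulus d \<le> Some g then 1 else 0)"
proof -
  have coeffs: "coeff (rescale g [:smax_neg d, 1:]) k
      = (if k = 0 then smax_neg d else if k = 1 then SPos g else 0)" for k
    by (auto simp: coeff_rescale coeff_pCons split: nat.split)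
  have "SPos g \<noteq> 0" by (simp add: zero_smax_def)
  then show ?thesis
    using smax_signed_neg[OF assms] unfolding flat_edge_def coeffs by (auto simp: smax_signed_def)
qed

lemma flat_edge_rescale_linear_mult:
  assumes "smax_signed d" "flat_edge (rescale g P) i j"
  shows "flat_edge (rescale g ([:smax_neg d, 1:] * P))
    ((if modulus d < Some g then 1 else 0) + i) ((if modulus d \<le> Some g then 1 else 0) + j)"
  using flat_edge_mult[OF flat_edge_rescale_linear[OF assms(1)] assms(2)]
  by (simp only: rescale_def pcompose_mult)

lemma smax_mult_ge_le_flat_edge:
  fixes P :: "'g::linordered_ab_group_add smax poly"
  assumes "smax_mult_ge m P \<gamma>" "smax_poly_signed P" "flat_edge (rescale g P) i j"
    and \<gamma>: "smax_signed \<gamma>" "modulus \<gamma> = Some g"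
  shows "i + m \<le> j"
  using assms(1-3)
proof (induction m arbitrary: P i j)
  case 0
  then show ?case by (simp add: flat_edge_le)
next
  case (Suc m)
  from Suc.prems(1) obtain Q where Q: "smax_poly_signed Q"
    "smax_poly_bal P ([:smax_neg \<gamma>, 1:] * Q)" "smax_mult_ge m Q \<gamma>" by auto
  have "Q \<noteq> 0"
  proof
    assume "Q = 0"
    then have "coeff P i = 0"
      using Q(2) Suc.prems(2) smax_signed_0 unfolding smax_poly_bal_def smax_poly_signed_def
      by (metis coeff_0 mult_zero_right smax_bal_signed_imp_eq)
    then show False using Suc.prems(3) by (simp add: flat_edge_def coeff_rescale)
  qed
  then obtain k l where edge: "flat_edge (rescale g Q) k l"
    using flat_edge_exists smax_poly_signed_rescale[OF Q(1)] rescale_eq_0_iff by metis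
  then have "flat_edge (rescale g ([:smax_neg \<gamma>, 1:] * Q)) k (Suc l)"
    using flat_edge_rescale_linear_mult[OF \<gamma>(1) edge] \<gamma>(2) by simp
  then have "flat_edge (rescale g P) k (Suc l)"
    using flat_edge_if_smax_poly_bal smax_poly_signed_rescale[OF Suc.prems(2)]
      smax_poly_bal_rescale[OF Q(2)] by blast
  then have "i = k" "j = Suc l" using flat_edge_unique[OF Suc.prems(3)] by auto
  then show ?case using Suc.IH[OF Q(3,1) edge] by simp
qed

definition smax_root_poly :: "'g::linordered_ab_group_add smax multiset \<Rightarrow> 'g smax poly" where
  "smax_root_poly D = (\<Prod>d\<in>#D. [:smax_neg d, 1:])"

lemma smax_root_poly_simps [simp]:
  "smax_root_poly {#} = 1"
  "smax_root_poly (add_mset d D) = [:smax_neg d, 1:] * smax_root_poly D"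
  by (simp_all add: smax_root_poly_def)

lemma smax_root_poly_eq_pcompose:
  "smax_root_poly D = smult (smax_neg 1 ^ size D) ((\<Prod>d\<in>#D. [:d, 1:]) \<circ>\<^sub>p [:0, smax_neg 1:])"
proof (induction D)
  case (add d D)
  have "[:smax_neg d, 1:] = smult (smax_neg 1) ([:d, 1:] \<circ>\<^sub>p [:0, smax_neg 1:])"
    by (simp add: pcompose_pCons flip: smax_neg_eq_mult)
  then have "smax_root_poly (add_mset d D)
      = smult (smax_neg 1) ([:d, 1:] \<circ>\<^sub>p [:0, smax_neg 1:]) * smax_root_poly D"
    by (simp only: smax_root_poly_simps)
  then show ?case
    by (simp only: add.IH size_add_mset power_Suc image_mset_add_mset prod_mset.add_mset
        pcompose_mult mult_smult_left mult_smult_right smult_smult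
        mult.commute[of "smax_neg 1"])
qed (simp add: pcompose_1)

text \<open>Replacing \<open>X\<close> by \<open>\<ominus>X\<close> reduces to the product of the \<open>X \<oplus> d\<close>, in whose coefficients no two
  terms have opposite signs.\<close>
lemma smax_root_poly_signed:
  fixes D :: "'g::linordered_ab_group_add smax multiset"
  assumes "\<forall>d\<in>#D. smax_less 0 d"
  shows "smax_poly_signed (smax_root_poly D)"
  unfolding smax_poly_signed_def
proof
  fix k
  have closed: "smax_pos_or_zero 0" "smax_pos_or_zero x \<Longrightarrow> smax_pos_or_zero y \<Longrightarrow> smax_pos_or_zero (x + y)"
    "smax_pos_or_zero x \<Longrightarrow> smax_pos_or_zero y \<Longrightarrow> smax_pos_or_zero (x * y)" for x y :: "'g smax"
    by (auto simp: smax_pos_or_zero_def SPos_add simp flip: zero_smax_def) (auto simp: smax_ops)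
  have "smax_pos_or_zero (coeff (\<Prod>d\<in>#D. [:d, 1:]) k)"
    using assms
  proof (induction D arbitrary: k)
    case empty
    then show ?case by (auto simp: coeff_1 smax_pos_or_zero_def smax_ops)
  next
    case (add d D)
    moreover obtain g where "d = SPos g" using add.prems by (auto simp: smax_less_0_iff)
    then have "smax_pos_or_zero (coeff [:d, 1:] i)" for i
      by (auto simp: coeff_pCons smax_pos_or_zero_def smax_ops split: nat.split)
    ultimately have "coeff ([:d, 1:] * (\<Prod>d\<in>#D. [:d, 1:])) k \<in> Collect smax_pos_or_zero"
      using closed by (intro coeff_mult_semiring_closed) auto
    then show ?case by (simp del: mult_pCons_left)
  qed
  then have "smax_signed (coeff (\<Prod>d\<in>#D. [:d, 1:]) k)"
    by (auto simp: smax_pos_or_zero_def smax_signed_def)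
  then show "smax_signed (coeff (smax_root_poly D) k)"
    unfolding smax_root_poly_eq_pcompose[of D]
    by (auto simp: coeff_pcompose_linear
        intro!: smax_signed_mult smax_signed_power smax_signed_neg smax_signed_1)
qed

lemma flat_edge_rescale_smax_root_poly:
  assumes "\<forall>d\<in>#D. smax_signed d"
  shows "flat_edge (rescale g (smax_root_poly D))
    (size {#d \<in># D. modulus d < Some g#}) (size {#d \<in># D. modulus d \<le> Some g#})"
  using assms
proof (induction D)
  case empty
  then show ?case
    by (auto simp: flat_edge_def coeff_rescale coeff_1 smax_signed_1)
next
  case (add d D)
  then show ?case
    using flat_edge_rescale_linear_mult[of d g "smax_root_poly D"]
    by (auto simp del: mult_pCons_left)
qed

lemma smax_root_poly_mult_ge:
  assumes "\<forall>d\<in>#D. smax_less 0 d" "m \<le> count D \<gamma>"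
  shows "smax_mult_ge m (smax_root_poly D) \<gamma>"
  using assms
proof (induction m arbitrary: D)
  case (Suc m)
  then obtain E where D: "D = add_mset \<gamma> E"
    by (metis Suc_le_eq count_eq_zero_iff less_nat_zero_code multi_member_split not_gr_zero)
  have "smax_poly_bal (smax_root_poly D) ([:smax_neg \<gamma>, 1:] * smax_root_poly E)"
    by (simp add: D smax_poly_bal_def smax_bal_refl)
  moreover have "smax_poly_signed (smax_root_poly E)"
    using Suc.prems by (intro smax_root_poly_signed) (auto simp: D)
  moreover have "smax_mult_ge m (smax_root_poly E) \<gamma>"
    using Suc.prems by (intro Suc.IH) (auto simp: D)
  ultimately show ?case by auto
qed auto

theorem smax_root_mult_root_poly:
  assumes D: "\<forall>d\<in>#D. smax_less 0 d" and "smax_less 0 \<gamma>"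
  shows "smax_root_mult (smax_root_poly D) \<gamma> = count D \<gamma>"
  unfolding smax_root_mult_def
proof (rule Greatest_equality)
  show "smax_mult_ge (count D \<gamma>) (smax_root_poly D) \<gamma>"
    using D by (rule smax_root_poly_mult_ge) simp
next
  fix m assume m: "smax_mult_ge m (smax_root_poly D) \<gamma>"
  obtain g where g: "\<gamma> = SPos g" using assms(2) by (auto simp: smax_less_0_iff)
  let ?less = "{#d \<in># D. modulus d < Some g#}"
  have "\<forall>d\<in>#D. smax_signed d" using D by (simp add: smax_signed_if_less_0)
  then have "size ?less + m \<le> size {#d \<in># D. modulus d \<le> Some g#}"
    using smax_mult_ge_le_flat_edge[OF m smax_root_poly_signed[OF D] flat_edge_rescale_smax_root_poly]
      smax_signed_if_less_0[OF assms(2)] g by simp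
  also have "{#d \<in># D. modulus d \<le> Some g#} = ?less + {#d \<in># D. d = \<gamma>#}"
    using D by (induction D) (auto simp: smax_less_0_iff g)
  finally show "m \<le> count D \<gamma>" by (simp add: filter_eq_replicate_mset)
qed

lemma smax_root_poly_inject:
  assumes "\<forall>d\<in>#D. smax_less 0 d" "\<forall>d\<in>#E. smax_less 0 d" "smax_root_poly D = smax_root_poly E"
  shows "D = E"
proof (rule multiset_eqI)
  fix x
  show "count D x = count E x"
  proof (cases "smax_less 0 x")
    case True
    then show ?thesis using smax_root_mult_root_poly assms by metis
  next
    case False
    then show ?thesis using assms(1,2) by (metis count_inI)
  qed
qed

lemma smax_bal_poly_smax_root_poly_iff:
  assumes "\<forall>d\<in>#D. smax_signed d" "smax_signed \<gamma>"
  shows "smax_bal (poly (smax_root_poly D) \<gamma>) 0 \<longleftrightarrow> \<gamma> \<in># D"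
  using assms(1)
proof (induction D)
  case empty
  then show ?case by (simp add: smax_bal_0_iff smax_balanced_def) (simp add: smax_ops)
next
  case (add d D)
  have "smax_balanced (\<gamma> + smax_neg d) \<longleftrightarrow> \<gamma> = d"
    using assms(2) add.prems smax_bal_signed_imp_eq[of \<gamma> d] smax_bal_refl[of d]
    by (auto simp: smax_bal_def smax_minus_def)
  moreover have "poly (smax_root_poly (add_mset d D)) \<gamma> = (\<gamma> + smax_neg d) * poly (smax_root_poly D) \<gamma>"
    by (simp add: algebra_simps)
  ultimately show ?case using add by (auto simp: smax_bal_0_iff smax_balanced_mult)
qed

theorem smax_alg_eig_mult_root_poly:
  assumes "smax_char_poly A = smax_root_poly D" "\<forall>d\<in>#D. smax_less 0 d"
  shows "smax_alg_eig_mult A \<gamma> = count D \<gamma>"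
proof -
  have signed: "\<forall>d\<in>#D. smax_signed d" using assms(2) by (simp add: smax_signed_if_less_0)
  show ?thesis
  proof (cases "\<gamma> \<in># D")
    case True
    then have "smax_signed \<gamma>" "smax_less 0 \<gamma>" using signed assms(2) by auto
    then show ?thesis
      using True smax_bal_poly_smax_root_poly_iff[OF signed] smax_root_mult_root_poly[OF assms(2)]
      by (simp add: smax_alg_eig_mult_def smax_det_shift_eq_poly assms(1))
  next
    case False
    then show ?thesis
      using smax_bal_poly_smax_root_poly_iff[OF signed]
      by (auto simp: smax_alg_eig_mult_def smax_det_shift_eq_poly assms(1) count_eq_zero_iff)
  qed
qed

theorem smax_TPD_char_poly:
  assumes tpd: "smax_TPD n A"
  shows "smax_char_poly A = smax_root_poly (mset (map (\<lambda>i. A $$ (i, i)) [0..<n]))"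
proof -
  have A: "A \<in> carrier_mat n n" using tpd by (simp add: smax_TPD_def)
  have "smax_char_poly A = (\<Prod>i<n. [:smax_neg (A $$ (i, i)), 1:])"
    by (intro smax_char_poly_diag_dominant A smax_TPD_off_diag_less[OF tpd])
  also have "\<dots> = smax_root_poly (mset (map (\<lambda>i. A $$ (i, i)) [0..<n]))"
    by (simp add: smax_root_poly_def prod_unfold_prod_mset multiset.map_comp comp_def
        flip: atLeast0LessThan)
  finally show ?thesis .
qed

section \<open>Monic split polynomials and Newton's identities\<close>

definition root_poly :: "'a::comm_ring_1 multiset \<Rightarrow> 'a poly" where
  "root_poly M = (\<Prod>x\<in>#M. [:- x, 1:])"

lemma root_poly_simps [simp]:
  "root_poly {#} = 1"
  "root_poly (add_mset x M) = [:- x, 1:] * root_poly M"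
  by (simp_all add: root_poly_def)

lemma poly_root_poly_eq_0_iff [simp]: "poly (root_poly M) x = 0 \<longleftrightarrow> x \<in># (M :: 'a::idom multiset)"
  by (auto simp: root_poly_def poly_prod_mset prod_mset_zero_iff)

lemma root_poly_nonzero [simp]: "root_poly M \<noteq> (0 :: 'a::idom poly)"
  by (auto simp: root_poly_def prod_mset_zero_iff)

lemma degree_root_poly [simp]: "degree (root_poly M) = size (M :: 'a::idom multiset)"
  by (induction M) (auto simp: degree_mult_eq simp del: mult_pCons_left)

lemma lead_coeff_root_poly [simp]: "coeff (root_poly M) (size M) = (1 :: 'a::idom)"
proof -
  have "lead_coeff (root_poly M) = 1"
    by (induction M) (simp_all add: lead_coeff_mult del: mult_pCons_left degree_root_poly)
  then show ?thesis by simp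
qed

lemma proots_root_poly [simp]: "proots (root_poly M) = (M :: 'a::idom multiset)"
  by (induction M) (auto simp: proots_mult simp del: mult_pCons_left)

lemma fps_of_poly_reflect_root_poly:
  "fps_of_poly (reflect_poly (root_poly M)) = (\<Prod>x\<in>#M. 1 - fps_const x * fps_X)"
  for M :: "'a::field multiset"
proof (induction M)
  case (add x M)
  have "reflect_poly [:- x, 1:] = [:1, - x:]"
    by (cases "x = 0") (simp_all add: reflect_poly_def)
  with add show ?case
    by (simp del: mult_pCons_left add: reflect_poly_mult fps_of_poly_mult fps_of_poly_linear')
qed simp

lemma fps_deriv_prod_linear:
  fixes M :: "'a::comm_ring_1 multiset"
  defines "E \<equiv> \<lambda>M. \<Prod>x\<in>#M. 1 - fps_const x * fps_X"
  shows "fps_deriv (E M) = - (E M * Abs_fps (\<lambda>m. \<Sum>x\<in>#M. x ^ Suc m))"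
proof (induction M)
  case empty
  have "Abs_fps (\<lambda>m. 0) = (0 :: 'a fps)" by (simp add: fps_eq_iff)
  then show ?case by (simp add: E_def)
next
  case (add x M)
  let ?L = "1 - fps_const x * fps_X" and ?G = "Abs_fps (\<lambda>m. x ^ Suc m)"
    and ?S = "Abs_fps (\<lambda>m. \<Sum>x\<in>#M. x ^ Suc m)"
  have geometric: "?L * ?G = fps_const x"
  proof (rule fps_ext)
    fix k show "(?L * ?G) $ k = fps_const x $ k"
      by (cases k) (simp_all add: ring_distribs mult.assoc)
  qed
  have "fps_deriv ?L = - fps_const x" by simp
  then have "fps_deriv (?L * E M) = ?L * fps_deriv (E M) - fps_const x * E M"
    by (simp only: fps_deriv_mult) (simp flip: fps_const_neg)
  also have "\<dots> = ?L * fps_deriv (E M) - ?L * ?G * E M"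
    by (simp only: geometric)
  also have "\<dots> = - (?L * E M * (?G + ?S))"
    unfolding add.IH by (simp add: algebra_simps)
  also have "?G + ?S = Abs_fps (\<lambda>m. \<Sum>x\<in>#add_mset x M. x ^ Suc m)"
    by (simp add: fps_eq_iff)
  finally show ?case by (simp add: E_def)
qed

lemma newton_identity:
  fixes M :: "'a::field multiset"
  defines "e \<equiv> coeff (reflect_poly (root_poly M))"
  shows "of_nat (Suc k) * e (Suc k) = - (\<Sum>i\<le>k. e i * (\<Sum>x\<in>#M. x ^ Suc (k - i)))"
proof -
  have "fps_deriv (fps_of_poly (reflect_poly (root_poly M))) $ k =
      - (fps_of_poly (reflect_poly (root_poly M)) * Abs_fps (\<lambda>m. \<Sum>x\<in>#M. x ^ Suc m)) $ k"
    by (simp add: fps_of_poly_reflect_root_poly fps_deriv_prod_linear)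
  then show ?thesis by (simp add: e_def fps_mult_nth atMost_atLeast0)
qed

lemma reflect_poly_coeffs_in_iff:
  assumes "0 \<in> K"
  shows "(\<forall>k. coeff (reflect_poly p) k \<in> K) \<longleftrightarrow> (\<forall>k. coeff p k \<in> K)"
proof
  assume reflected: "\<forall>k. coeff (reflect_poly p) k \<in> K"
  show "\<forall>k. coeff p k \<in> K"
  proof
    fix k show "coeff p k \<in> K"
      using assms spec[OF reflected, of "degree p - k"]
      by (cases "k \<le> degree p") (auto simp: coeff_reflect_poly coeff_eq_0 split: if_splits)
  qed
qed (use assms in \<open>auto simp: coeff_reflect_poly\<close>)

locale closed_subfield =
  fixes K :: "'a::field_char_0 set"
  assumes one_closed: "1 \<in> K"
    and diff_closed: "x \<in> K \<Longrightarrow> y \<in> K \<Longrightarrow> x - y \<in> K"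
    and divide_closed: "x \<in> K \<Longrightarrow> y \<in> K \<Longrightarrow> x / y \<in> K"
begin

lemma zero_closed: "0 \<in> K"
  using diff_closed[OF one_closed one_closed] by simp

lemma uminus_closed: "x \<in> K \<Longrightarrow> - x \<in> K"
  using diff_closed[OF zero_closed, of x] by simp

lemma add_closed: "x \<in> K \<Longrightarrow> y \<in> K \<Longrightarrow> x + y \<in> K"
  using diff_closed[OF _ uminus_closed, of x y] by simp

lemma mult_closed: "x \<in> K \<Longrightarrow> y \<in> K \<Longrightarrow> x * y \<in> K"
  using divide_closed[OF _ divide_closed[OF one_closed], of x y] by simp

lemma of_nat_closed: "of_nat n \<in> K"
  by (induction n) (auto intro: zero_closed one_closed add_closed)

lemma power_closed: "x \<in> K \<Longrightarrow> x ^ n \<in> K"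
  by (induction n) (auto intro: one_closed mult_closed)

lemma sum_closed: "(\<And>i. i \<in> S \<Longrightarrow> f i \<in> K) \<Longrightarrow> sum f S \<in> K"
  by (induction S rule: infinite_finite_induct) (auto intro: zero_closed add_closed)

lemmas closed = zero_closed one_closed diff_closed divide_closed uminus_closed add_closed mult_closed
  of_nat_closed power_closed sum_closed

lemma power_sums_closed:
  assumes "\<forall>k. coeff (root_poly M) k \<in> K"
  shows "(\<Sum>x\<in>#M. x ^ m) \<in> K"
proof (induction m rule: less_induct)
  case (less m)
  let ?e = "coeff (reflect_poly (root_poly M))" and ?p = "\<lambda>m. \<Sum>x\<in>#M. x ^ m"
  have e: "?e k \<in> K" for k
    using assms reflect_poly_coeffs_in_iff[OF zero_closed] by blast
  show ?case
  proof (cases m)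
    case 0
    then show ?thesis by (simp add: of_nat_closed)
  next
    case (Suc k)
    have "of_nat (Suc k) * ?e (Suc k) = - (?e 0 * ?p m + (\<Sum>i\<in>{..k} - {0}. ?e i * ?p (Suc (k - i))))"
      unfolding newton_identity by (subst sum.remove[of _ 0]) (simp_all add: Suc)
    then have "?p m = - (of_nat (Suc k) * ?e (Suc k)) - (\<Sum>i\<in>{..k} - {0}. ?e i * ?p (Suc (k - i)))"
      by (simp del: of_nat_Suc power_Suc)
    also have "\<dots> \<in> K"
      by (intro closed e less.IH) (auto simp: Suc)
    finally show ?thesis .
  qed
qed

lemma root_poly_coeffs_closed:
  assumes "\<And>m. (\<Sum>x\<in>#M. x ^ m) \<in> K"
  shows "\<forall>k. coeff (root_poly M) k \<in> K"
proof -
  let ?e = "coeff (reflect_poly (root_poly M))"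
  have "?e k \<in> K" for k
  proof (induction k rule: less_induct)
    case (less k)
    show ?case
    proof (cases k)
      case 0
      then show ?thesis by (simp add: one_closed)
    next
      case (Suc j)
      have "?e k = - (\<Sum>i\<le>j. ?e i * (\<Sum>x\<in>#M. x ^ Suc (j - i))) / of_nat (Suc j)"
        unfolding Suc newton_identity[symmetric] by (simp del: of_nat_Suc)
      also have "\<dots> \<in> K"
        by (intro closed less.IH assms) (auto simp: Suc)
      finally show ?thesis .
    qed
  qed
  then show ?thesis using reflect_poly_coeffs_in_iff[OF zero_closed] by blast
qed

end

definition pair_products :: "nat \<Rightarrow> (nat \<Rightarrow> 'a::comm_ring_1) \<Rightarrow> 'a multiset" where
  "pair_products n x = image_mset (\<lambda>(j, i). x i * x j) (mset_set (SIGMA j:{..<n}. {..<j}))"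

lemma sum_pair_products: "(\<Sum>z\<in>#pair_products n x. f z) = (\<Sum>j<n. \<Sum>i<j. f (x i * x j))"
  by (simp add: pair_products_def multiset.map_comp comp_def case_prod_beta sum.Sigma
      flip: sum_unfold_sum_mset)

lemma set_pair_products: "set_mset (pair_products n x) = {x i * x j | i j. i < j \<and> j < n}"
  by (force simp: pair_products_def)

lemma size_pair_products: "2 * size (pair_products n x) = n * (n - 1)"
proof -
  have "size (pair_products n x) = (\<Sum>j<n. j)"
    by (simp add: pair_products_def)
  then show ?thesis
    using double_gauss_sum[where 'a = nat, of "n - 1"]
    by (cases n) (simp_all add: lessThan_Suc_atMost atMost_atLeast0)
qed

lemma sum_square_eq_sum_pairs:
  fixes f :: "nat \<Rightarrow> 'a::comm_ring_1"
  shows "(\<Sum>i<n. f i) ^ 2 = (\<Sum>i<n. f i ^ 2) + 2 * (\<Sum>j<n. \<Sum>i<j. f i * f j)"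
  by (induction n) (simp_all add: power2_sum sum_distrib_left algebra_simps)

context closed_subfield
begin

lemma shifted_power_sums_closed:
  fixes x :: "nat \<Rightarrow> 'a"
  assumes "\<And>m. (\<Sum>i<n. x i ^ m) \<in> K" "c \<in> K"
  shows "(\<Sum>i<n. (x i + c) ^ m) \<in> K"
proof -
  have "(\<Sum>i<n. (x i + c) ^ m) =
      (\<Sum>l\<le>m. of_nat (m choose l) * (\<Sum>i<n. x i ^ l) * c ^ (m - l))"
    unfolding binomial_ring by (subst sum.swap) (simp only: sum_distrib_left sum_distrib_right)
  also have "\<dots> \<in> K" by (intro closed assms)
  finally show ?thesis .
qed

lemma pair_product_power_sums_closed:
  assumes "\<And>m. (\<Sum>i<n. x i ^ m) \<in> K"
  shows "(\<Sum>z\<in>#pair_products n x. z ^ m) \<in> K"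
proof -
  have "(\<Sum>z\<in>#pair_products n x. z ^ m) = ((\<Sum>i<n. x i ^ m) ^ 2 - (\<Sum>i<n. x i ^ (m * 2))) / of_nat 2"
    unfolding sum_pair_products sum_square_eq_sum_pairs by (simp add: power_mult power_mult_distrib)
  also have "\<dots> \<in> K" by (intro closed assms)
  finally show ?thesis .
qed

lemma root_poly_shifted_pair_products_closed:
  assumes "\<forall>k. coeff (root_poly (image_mset x (mset_set {..<n}))) k \<in> K" "c \<in> K"
  shows "\<forall>k. coeff (root_poly (pair_products n (\<lambda>i. x i + c))) k \<in> K"
proof -
  have "(\<Sum>i<n. x i ^ m) \<in> K" for m
    using power_sums_closed[OF assms(1), of m] by (simp add: sum_unfold_sum_mset multiset.map_comp comp_def)
  then show ?thesis
    using assms(2)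
    by (intro root_poly_coeffs_closed pair_product_power_sums_closed shifted_power_sums_closed)
qed

lemma sum_prod_closed_if_shifted_products_closed:
  assumes "(x + c) * (y + c) \<in> K" "(x + d) * (y + d) \<in> K" "c \<in> K" "d \<in> K" "c \<noteq> d"
  shows "x + y \<in> K" "x * y \<in> K"
proof -
  have "x + y = ((x + c) * (y + c) - (x + d) * (y + d)) / (c - d) - (c + d)"
    using assms(5) by (simp add: field_simps)
  also have "\<dots> \<in> K" by (intro closed assms)
  finally show sum: "x + y \<in> K" .
  have "x * y = (x + c) * (y + c) - (c * (x + y) + c * c)"
    by (simp add: algebra_simps)
  also have "\<dots> \<in> K" by (intro closed assms sum)
  finally show "x * y \<in> K" .
qed

end

section \<open>Real closed fields\<close>

interpretation to_ac: field_hom "to_ac :: 'a::field \<Rightarrow> 'a alg_closure"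
  by standard simp_all

interpretation range_to_ac: closed_subfield "range (to_ac :: 'a::field_char_0 \<Rightarrow> 'a alg_closure)"
proof
  show "1 \<in> range (to_ac :: 'a \<Rightarrow> 'a alg_closure)" by (metis rangeI to_ac_1)
qed (auto simp flip: to_ac_diff to_ac_divide)

definition ac_i :: "'a::field alg_closure" where
  "ac_i = (SOME z. z ^ 2 = - 1)"

lemma ac_i_square: "ac_i * ac_i = - 1"
proof -
  have "ac_i ^ 2 = - 1"
    unfolding ac_i_def by (rule someI_ex) (rule nth_root_exists, simp)
  then show ?thesis by (simp add: power2_eq_square)
qed

definition gauss :: "'a::field \<Rightarrow> 'a \<Rightarrow> 'a alg_closure" where
  "gauss a b = to_ac a + to_ac b * ac_i"

definition gauss_field :: "'a::field alg_closure set" where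
  "gauss_field = {gauss a b | a b. True}"

lemma gauss_in_gauss_field: "gauss a b \<in> gauss_field"
  by (auto simp: gauss_field_def)

lemma gauss_diff: "gauss a b - gauss c d = gauss (a - c) (b - d)"
  by (simp add: gauss_def algebra_simps)

lemma gauss_mult: "gauss a b * gauss c d = gauss (a * c - b * d) (a * d + b * c)"
proof -
  have "gauss a b * gauss c d
      = to_ac (a * c) + to_ac (b * d) * (ac_i * ac_i) + to_ac (a * d + b * c) * ac_i"
    by (simp add: gauss_def algebra_simps)
  then show ?thesis by (simp add: ac_i_square gauss_def)
qed

lemma gauss_real: "gauss a 0 = to_ac a"
  by (simp add: gauss_def)

lemma gauss_divide:
  fixes a b c d :: "'a::linordered_field"
  defines "r \<equiv> c * c + d * d"
  shows "gauss a b / gauss c d = gauss ((a * c + b * d) / r) ((b * c - a * d) / r)"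
proof (cases "r = 0")
  case True
  then have "c = 0" "d = 0" by (simp_all add: r_def sum_squares_eq_zero_iff)
  then show ?thesis by (simp add: r_def gauss_real)
next
  case False
  have norm: "gauss c d * gauss c (- d) = to_ac r"
    by (simp add: gauss_mult r_def gauss_real)
  then have "gauss c d \<noteq> 0" "gauss c (- d) \<noteq> 0" using False by auto
  then have "gauss a b / gauss c d = gauss a b * gauss c (- d) / to_ac r"
    by (simp flip: norm)
  also have "\<dots> = gauss ((a * c + b * d) / r) ((b * c - a * d) / r)"
    using False by (simp add: gauss_mult) (simp add: gauss_def field_simps)
  finally show ?thesis .
qed

interpretation gauss_field: closed_subfield "gauss_field :: 'a::linordered_field alg_closure set"
proof
  show "1 \<in> (gauss_field :: 'a alg_closure set)"
    using gauss_in_gauss_field[of 1 0] by (simp add: gauss_real)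
qed (auto simp: gauss_field_def gauss_diff gauss_divide, blast+)

lemma real_closed_field_sqrt:
  fixes x :: "'a::linordered_field"
  assumes "real_closed_field TYPE('a)" "0 \<le> x"
  obtains y where "0 \<le> y" "y * y = x"
proof -
  obtain y where "y * y = x" using assms by (auto simp: real_closed_field_def)
  then show thesis by (intro that[of "\<bar>y\<bar>"]) auto
qed

text \<open>With \<open>r = \<bar>a + bi\<bar>\<close>, the square root is \<open>u + ti\<close> where \<open>u\<^sup>2 = (r + a)/2\<close>, \<open>t\<^sup>2 = (r - a)/2\<close>.\<close>
lemma gauss_field_sqrt:
  fixes z :: "'a::linordered_field alg_closure"
  assumes rcf: "real_closed_field TYPE('a)" and "z \<in> gauss_field"
  obtains w where "w \<in> gauss_field" "w * w = z"
proof -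
  obtain a b where z: "z = gauss a b" using assms(2) by (auto simp: gauss_field_def)
  obtain r where r: "0 \<le> r" "r * r = a * a + b * b"
    using real_closed_field_sqrt[OF rcf, of "a * a + b * b"] by auto
  have "a\<^sup>2 \<le> r\<^sup>2" using r(2) by (simp add: power2_eq_square)
  then have "\<bar>a\<bar> \<le> r" using r(1) by (simp add: abs_le_square_iff[symmetric])
  then have nonneg: "0 \<le> (r + a) / 2" "0 \<le> (r - a) / 2" by auto
  obtain u where u: "u * u = (r + a) / 2" using real_closed_field_sqrt[OF rcf nonneg(1)] by blast
  obtain t where t: "t * t = (r - a) / 2" using real_closed_field_sqrt[OF rcf nonneg(2)] by blast
  have "(2 * u * t) * (2 * u * t) = 4 * (u * u) * (t * t)" by (simp add: algebra_simps)
  also have "\<dots> = b * b" unfolding u t using r(2) by (simp add: field_simps)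
  finally have "2 * u * t = b \<or> 2 * u * t = - b" by (simp only: square_eq_iff)
  then obtain t' where t': "t' * t' = (r - a) / 2" "2 * u * t' = b"
    using t by (metis minus_mult_minus mult_minus_right minus_minus)
  have "u * u - t' * t' = a" unfolding u t' by (simp add: field_simps)
  then have "gauss u t' * gauss u t' = z"
    using t'(2) by (simp add: gauss_mult z algebra_simps)
  then show thesis using gauss_in_gauss_field by (rule that[rotated])
qed

lemma gauss_field_root_of_quadratic:
  fixes x y :: "'a::linordered_field alg_closure"
  assumes rcf: "real_closed_field TYPE('a)" and sum: "x + y \<in> gauss_field" and prod: "x * y \<in> gauss_field"
  shows "x \<in> gauss_field"
proof -
  have "(x - y) * (x - y) = (x + y) * (x + y) - of_nat 4 * (x * y)" by (simp add: algebra_simps)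
  also have "\<dots> \<in> gauss_field" by (intro gauss_field.closed sum prod)
  finally obtain w where w: "w \<in> gauss_field" "w * w = (x - y) * (x - y)"
    by (rule gauss_field_sqrt[OF rcf])
  then have "x - y = w \<or> x - y = - w" by (metis square_eq_iff)
  then have "x - y \<in> gauss_field" using w(1) gauss_field.uminus_closed by auto
  with sum have "(x + y) + (x - y) \<in> gauss_field" by (rule gauss_field.add_closed)
  then have "((x + y) + (x - y)) / of_nat 2 \<in> gauss_field"
    by (intro gauss_field.divide_closed gauss_field.of_nat_closed)
  then show ?thesis by simp
qed

text \<open>Laplace's trick: two of the infinitely many shifts select the same pair.\<close>
lemma gauss_field_member_if_shifted_pair_products:
  fixes x :: "nat \<Rightarrow> 'a::linordered_field alg_closure"
  assumes rcf: "real_closed_field TYPE('a)"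
    and pair: "\<And>c::nat. \<exists>z\<in>#pair_products n (\<lambda>i. x i + of_nat c). z \<in> gauss_field"
  shows "\<exists>i<n. x i \<in> gauss_field"
proof -
  have "\<exists>i<n. \<exists>j<n. (x i + of_nat c) * (x j + of_nat c) \<in> gauss_field" for c
    using pair[of c] by (auto simp: set_pair_products) (meson less_trans)
  then obtain i j where ij: "i c < n" "j c < n" "(x (i c) + of_nat c) * (x (j c) + of_nat c) \<in> gauss_field"
    for c by metis
  have "finite (range (\<lambda>c. (i c, j c)))"
    by (rule finite_subset[of _ "{..<n} \<times> {..<n}"]) (use ij in auto)
  then have "\<not> inj (\<lambda>c. (i c, j c))" using finite_imageD infinite_UNIV_nat by blast
  then obtain c d where "c \<noteq> d" "i c = i d" "j c = j d" by (auto simp: inj_def)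
  then have "x (i c) + x (j c) \<in> gauss_field" "x (i c) * x (j c) \<in> gauss_field"
    using gauss_field.sum_prod_closed_if_shifted_products_closed[of "x (i c)" "of_nat c" "x (j c)" "of_nat d"]
      ij[of c] ij[of d] gauss_field.of_nat_closed by auto
  then show ?thesis
    using gauss_field_root_of_quadratic[OF rcf] ij(1) by blast
qed

lemma map_poly_to_ac_if_coeffs_in_range:
  assumes "\<forall>k. coeff p k \<in> range to_ac"
  obtains q where "p = map_poly to_ac q"
proof
  show "p = map_poly to_ac (map_poly of_ac p)"
    using assms by (intro poly_eqI) (simp add: coeff_map_poly to_ac_of_ac)
qed

lemma alg_closure_factorization:
  fixes p :: "'a::field poly"
  assumes "p \<noteq> 0"
  obtains x where "map_poly to_ac p
      = smult (to_ac (lead_coeff p)) (root_poly (image_mset x (mset_set {..<degree p})))"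
    and "\<forall>k. coeff (root_poly (image_mset x (mset_set {..<degree p}))) k \<in> range to_ac"
proof -
  obtain M where M: "size M = degree p" "map_poly to_ac p = smult (to_ac (lead_coeff p)) (root_poly M)"
    using alg_closed_imp_factorization[of "map_poly to_ac p"] assms by (auto simp: root_poly_def)
  obtain xs where "mset xs = M" using ex_mset by blast
  then have "image_mset (nth xs) (mset_set {..<degree p}) = M"
    using M(1) by (metis atLeast0LessThan map_nth mset_map mset_upt size_mset)
  moreover have "coeff (root_poly M) k = to_ac (coeff p k / lead_coeff p)" for k
    using assms arg_cong[OF M(2), of "\<lambda>q. coeff q k"] by (simp add: field_simps)
  then have "\<forall>k. coeff (root_poly M) k \<in> range to_ac" by (metis rangeI)
  ultimately show thesis using M(2) by (intro that[of "nth xs"]) simp_all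
qed

text \<open>Laplace's argument: the polynomial with roots \<open>(x\<^sub>i + c)(x\<^sub>j + c)\<close>, \<open>i < j\<close>, has degree
  \<open>n(n - 1)/2\<close>, which is divisible by a smaller power of \<open>2\<close> than \<open>n\<close>.\<close>
lemma gauss_field_root_if_degree_two_power_times_odd:
  fixes p :: "'a::linordered_field poly"
  assumes rcf: "real_closed_field TYPE('a)" and "degree p = 2 ^ k * m" "odd m"
  shows "\<exists>z\<in>gauss_field. poly (map_poly to_ac p) z = 0"
  using assms(2,3)
proof (induction k arbitrary: p m)
  case 0
  then obtain x where "poly p x = 0" using rcf by (auto simp: real_closed_field_def)
  then have "poly (map_poly to_ac p) (gauss x 0) = 0" by (simp add: gauss_real)
  then show ?case using gauss_in_gauss_field by blast
next
  case (Suc k)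
  define n where "n = degree p"
  have n: "n = 2 * (2 ^ k * m)" "n > 0"
    using Suc.prems by (auto simp: n_def intro!: Nat.gr0I)
  then have "p \<noteq> 0" by (auto simp: n_def)
  then obtain x where x: "map_poly to_ac p
      = smult (to_ac (lead_coeff p)) (root_poly (image_mset x (mset_set {..<n})))"
    and in_range: "\<forall>l. coeff (root_poly (image_mset x (mset_set {..<n}))) l \<in> range to_ac"
    unfolding n_def by (rule alg_closure_factorization)
  have "\<exists>z\<in>#pair_products n (\<lambda>i. x i + of_nat c). z \<in> gauss_field" for c
  proof -
    obtain q where q: "root_poly (pair_products n (\<lambda>i. x i + of_nat c)) = map_poly to_ac q"
      using range_to_ac.root_poly_shifted_pair_products_closed[OF in_range range_to_ac.of_nat_closed]
      by (rule map_poly_to_ac_if_coeffs_in_range)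
    have "2 * degree q = n * (n - 1)"
      using arg_cong[OF q, of degree] size_pair_products[of n "\<lambda>i. x i + of_nat c"] by simp
    then have "degree q = 2 ^ k * (m * (n - 1))" using n by simp
    moreover have "odd (m * (n - 1))" using n Suc.prems(2) by simp
    ultimately obtain z where "z \<in> gauss_field" "poly (map_poly to_ac q) z = 0"
      using Suc.IH by blast
    then show ?thesis by (auto simp flip: q)
  qed
  then obtain i where "i < n" "x i \<in> gauss_field"
    using gauss_field_member_if_shifted_pair_products[OF rcf] by blast
  moreover from this have "poly (map_poly to_ac p) (x i) = 0" unfolding x by simp
  ultimately show ?case by blast
qed

theorem gauss_field_root_exists:
  fixes p :: "'a::linordered_field poly"
  assumes rcf: "real_closed_field TYPE('a)" and "degree p > 0"
  shows "\<exists>z\<in>gauss_field. poly (map_poly to_ac p) z = 0"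
proof -
  obtain m where "degree p = 2 ^ multiplicity 2 (degree p) * m" "odd m"
    using multiplicity_decompose'[of "degree p" 2] assms(2) by auto
  then show ?thesis by (rule gauss_field_root_if_degree_two_power_times_odd[OF rcf])
qed

lemma splits_if_gauss_roots_real:
  fixes p :: "'a::linordered_field poly"
  assumes rcf: "real_closed_field TYPE('a)" and "p \<noteq> 0"
    and "\<And>a b. poly (map_poly to_ac p) (gauss a b) = 0 \<Longrightarrow> b = 0"
  shows "\<exists>M. p = smult (lead_coeff p) (root_poly M)"
  using assms(2,3)
proof (induction "degree p" arbitrary: p)
  case 0
  then show ?case by (intro exI[of _ "{#}"]) (auto elim: degree_eq_zeroE)
next
  case (Suc n)
  interpret map_poly_to_ac: map_poly_comm_ring_hom "to_ac :: 'a \<Rightarrow> 'a alg_closure" ..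
  obtain a b where root: "poly (map_poly to_ac p) (gauss a b) = 0"
    using gauss_field_root_exists[OF rcf, of p] Suc.hyps by (auto simp: gauss_field_def)
  then have "b = 0" by (rule Suc.prems)
  then have "poly p a = 0" using root by (simp add: gauss_real)
  then obtain q where q: "p = [:- a, 1:] * q" by (metis dvdE poly_eq_0_iff_dvd)
  have "q \<noteq> 0" using q Suc.prems by auto
  have deg: "n = degree q"
    using Suc.hyps(2) q \<open>q \<noteq> 0\<close> by (simp add: degree_mult_eq del: mult_pCons_left)
  have "b = 0" if "poly (map_poly to_ac q) (gauss a' b) = 0" for a' b
    using Suc.prems(2)[of a' b] that by (simp add: q map_poly_to_ac.hom_mult del: mult_pCons_left)
  then obtain M where M: "q = smult (lead_coeff q) (root_poly M)"
    using Suc.hyps(1)[OF deg \<open>q \<noteq> 0\<close>] by blast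
  have "p = smult (lead_coeff q) (root_poly (add_mset a M))"
    unfolding q by (subst M) simp
  moreover have "lead_coeff p = lead_coeff q"
    using q by (simp add: lead_coeff_mult del: mult_pCons_left)
  ultimately show ?case by metis
qed

section \<open>Symmetric matrices over real closed fields\<close>

lemma scalar_prod_self_nonneg: "0 \<le> (v :: 'a::linordered_idom vec) \<bullet> v"
  by (auto simp: scalar_prod_def intro: sum_nonneg)

lemma scalar_prod_self_pos:
  fixes v :: "'a::linordered_idom vec"
  assumes "v \<in> carrier_vec n" "v \<noteq> 0\<^sub>v n"
  shows "0 < v \<bullet> v"
proof -
  obtain i where "i < n" "v $ i \<noteq> 0"
    using assms by (metis eq_vecI carrier_vecD index_zero_vec)
  then show ?thesis
    using assms(1) by (auto simp: scalar_prod_def zero_less_mult_iff intro!: sum_pos2[of _ i])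
qed

lemma symmetric_square_plus_scalar_form:
  fixes S :: "'a::comm_ring_1 mat"
  assumes S: "S \<in> carrier_mat n n" "S\<^sup>T = S" and v: "v \<in> carrier_vec n"
  shows "v \<bullet> ((S * S + c \<cdot>\<^sub>m 1\<^sub>m n) *\<^sub>v v) = (S *\<^sub>v v) \<bullet> (S *\<^sub>v v) + c * (v \<bullet> v)"
proof -
  have Sv: "S *\<^sub>v v \<in> carrier_vec n" using S v by simp
  have "(c \<cdot>\<^sub>m 1\<^sub>m n) *\<^sub>v v = c \<cdot>\<^sub>v v"
    using v by (intro eq_vecI) auto
  then have "(S * S + c \<cdot>\<^sub>m 1\<^sub>m n) *\<^sub>v v = S *\<^sub>v (S *\<^sub>v v) + c \<cdot>\<^sub>v v"
    using S v by (subst add_mult_distrib_mat_vec[of _ n n]) auto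
  then have "v \<bullet> ((S * S + c \<cdot>\<^sub>m 1\<^sub>m n) *\<^sub>v v) = v \<bullet> (S *\<^sub>v (S *\<^sub>v v)) + c * (v \<bullet> v)"
    using S v Sv by (simp add: scalar_prod_add_distrib[of _ n])
  also have "v \<bullet> (S *\<^sub>v (S *\<^sub>v v)) = (S *\<^sub>v v) \<bullet> (S *\<^sub>v v)"
    using transpose_vec_mult_scalar[OF S(1) Sv v] S(2) by simp
  finally show ?thesis .
qed

lemma mat_difference_of_squares:
  fixes S :: "'a::comm_ring_1 mat"
  assumes S: "S \<in> carrier_mat n n"
  shows "(S + (- c) \<cdot>\<^sub>m 1\<^sub>m n) * (S + c \<cdot>\<^sub>m 1\<^sub>m n) = S * S + (- (c * c)) \<cdot>\<^sub>m 1\<^sub>m n"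
proof -
  let ?C = "S + c \<cdot>\<^sub>m 1\<^sub>m n"
  have C: "?C \<in> carrier_mat n n" using S by simp
  have "(S + (- c) \<cdot>\<^sub>m 1\<^sub>m n) * ?C = S * ?C + ((- c) \<cdot>\<^sub>m 1\<^sub>m n) * ?C"
    using S C by (intro add_mult_distrib_mat) auto
  also have "S * ?C = S * S + c \<cdot>\<^sub>m S"
    using S by (subst mult_add_distrib_mat[OF S S]) (auto simp: mult_smult_distrib[OF S])
  also have "((- c) \<cdot>\<^sub>m 1\<^sub>m n) * ?C = (- c) \<cdot>\<^sub>m ?C"
    using C by (subst mult_smult_assoc_mat[of _ n n]) auto
  also have "S * S + c \<cdot>\<^sub>m S + (- c) \<cdot>\<^sub>m ?C = S * S + (- (c * c)) \<cdot>\<^sub>m 1\<^sub>m n"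
    using S by (intro eq_matI) (auto simp: algebra_simps simp del: index_mult_mat(1))
  finally show ?thesis .
qed

text \<open>If \<open>a + bi\<close> is an eigenvalue then \<open>(A - a)\<^sup>2 + b\<^sup>2\<close> is singular already over the real closed
  field, whereas its quadratic form is at least \<open>b\<^sup>2\<close> times the norm square.\<close>
lemma symmetric_gauss_eigenvalue_real:
  fixes A :: "'a::linordered_field mat"
  assumes A: "A \<in> carrier_mat n n" and sym: "A\<^sup>T = A"
    and root: "poly (map_poly to_ac (char_poly A)) (gauss a b) = 0"
  shows "b = 0"
proof (rule ccontr)
  assume "b \<noteq> 0"
  define S where "S = char_matrix A a"
  define N where "N = S * S + (b * b) \<cdot>\<^sub>m 1\<^sub>m n"
  have S: "S \<in> carrier_mat n n" "S\<^sup>T = S" and N: "N \<in> carrier_mat n n"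
    using A sym by (auto simp: S_def N_def char_matrix_def transpose_add[of _ n n])
  define S' \<beta> where "S' = map_mat to_ac S" and "\<beta> = to_ac b * ac_i"
  have "\<beta> * \<beta> = to_ac (b * b) * (ac_i * ac_i)" by (simp add: \<beta>_def)
  then have "- (\<beta> * \<beta>) = to_ac (b * b)" by (simp add: ac_i_square)
  then have "map_mat to_ac N = S' * S' + (- (\<beta> * \<beta>)) \<cdot>\<^sub>m 1\<^sub>m n"
    using S N by (intro eq_matI) (auto simp: N_def S'_def to_ac.mat_hom_mult[OF S(1) S(1), symmetric]
        simp del: index_mult_mat(1))
  then have factors: "map_mat to_ac N = (S' + (- \<beta>) \<cdot>\<^sub>m 1\<^sub>m n) * (S' + \<beta> \<cdot>\<^sub>m 1\<^sub>m n)"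
    using S by (subst mat_difference_of_squares) (simp_all add: S'_def)
  have A': "map_mat to_ac A \<in> carrier_mat n n" using A by simp
  have "char_matrix (map_mat to_ac A) (gauss a b) = S' + (- \<beta>) \<cdot>\<^sub>m 1\<^sub>m n"
    using A by (intro eq_matI) (auto simp: char_matrix_def S'_def S_def gauss_def \<beta>_def)
  moreover have "eigenvalue (map_mat to_ac A) (gauss a b)"
    unfolding eigenvalue_root_char_poly[OF A'] to_ac.char_poly_hom[OF A] by (rule root)
  ultimately have "det (S' + (- \<beta>) \<cdot>\<^sub>m 1\<^sub>m n) = 0" using eigenvalue_det[OF A'] by simp
  then have "det (map_mat to_ac N) = 0"
    unfolding factors using S by (subst det_mult[of _ n]) (auto simp: S'_def)
  then have "det N = 0" unfolding to_ac.hom_det by simp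
  then obtain v where v: "v \<in> carrier_vec n" "v \<noteq> 0\<^sub>v n" "N *\<^sub>v v = 0\<^sub>v n"
    using det_0_iff_vec_prod_zero_field[OF N] by blast
  then have "(S *\<^sub>v v) \<bullet> (S *\<^sub>v v) + (b * b) * (v \<bullet> v) = 0"
    using symmetric_square_plus_scalar_form[OF S v(1), of "b * b"] by (simp add: N_def)
  moreover have "0 < (b * b) * (v \<bullet> v)"
    using \<open>b \<noteq> 0\<close> scalar_prod_self_pos[OF v(1,2)] by (auto simp: zero_less_mult_iff)
  ultimately show False using scalar_prod_self_nonneg[of "S *\<^sub>v v"] by linarith
qed

theorem symmetric_char_poly_splits:
  fixes A :: "'a::linordered_field mat"
  assumes rcf: "real_closed_field TYPE('a)" and A: "A \<in> carrier_mat n n" "A\<^sup>T = A"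
  obtains M where "char_poly A = root_poly M"
proof -
  have monic: "lead_coeff (char_poly A) = 1" using degree_monic_char_poly[OF A(1)] by simp
  then have "char_poly A \<noteq> 0" by auto
  then obtain M where "char_poly A = smult (lead_coeff (char_poly A)) (root_poly M)"
    using splits_if_gauss_roots_real[OF rcf] symmetric_gauss_eigenvalue_real[OF A] by blast
  then show thesis using that monic by simp
qed

lemma pos_def_mat_root_pos:
  fixes A :: "'a::linordered_field mat"
  assumes pd: "pos_def_mat n A" and root: "poly (char_poly A) x = 0"
  shows "x > 0"
proof -
  have A: "A \<in> carrier_mat n n" using pd by (simp add: pos_def_mat_def)
  have "eigenvalue A x" using root eigenvalue_root_char_poly[OF A] by simp
  then obtain v where v: "v \<in> carrier_vec n" "v \<noteq> 0\<^sub>v n" "A *\<^sub>v v = x \<cdot>\<^sub>v v"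
    using A by (auto simp: eigenvalue_def eigenvector_def)
  have "0 < v \<bullet> (A *\<^sub>v v)" using pd v(1,2) by (simp add: pos_def_mat_def)
  also have "\<dots> = x * (v \<bullet> v)" unfolding v(3) using v(1) by simp
  finally show ?thesis using scalar_prod_self_nonneg[of v] by (auto simp: zero_less_mult_iff)
qed

section \<open>Lifting tropical identities along the signed valuation\<close>

text \<open>A balanced element represents everything of at most its modulus. In contrast to \<open>signed_val\<close>
  itself, this relation is compatible with addition.\<close>
fun lifts ::
  "('a::linordered_field \<Rightarrow> 'g::linordered_ab_group_add option) \<Rightarrow> 'a \<Rightarrow> 'g smax \<Rightarrow> bool" where
  "lifts v x SZero \<longleftrightarrow> x = 0"
| "lifts v x (SPos g) \<longleftrightarrow> x > 0 \<and> v x = Some g"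
| "lifts v x (SNeg g) \<longleftrightarrow> x < 0 \<and> v x = Some g"
| "lifts v x (SBal g) \<longleftrightarrow> v x \<le> Some g"

definition poly_lifts ::
  "('a::linordered_field \<Rightarrow> 'g::linordered_ab_group_add option) \<Rightarrow> 'a poly \<Rightarrow> 'g smax poly \<Rightarrow> bool" where
  "poly_lifts v p P \<longleftrightarrow> (\<forall>k. lifts v (coeff p k) (coeff P k))"

lemma signed_val_eq_if_lifts: "lifts v x s \<Longrightarrow> smax_signed s \<Longrightarrow> signed_val v x = s"
  by (cases s) (auto simp: signed_val_def smax_signed_def)

lemma poly_lifts_signed_unique:
  assumes "poly_lifts v p P" "poly_lifts v p Q" "smax_poly_signed P" "smax_poly_signed Q"
  shows "P = Q"
  using assms by (intro poly_eqI) (metis signed_val_eq_if_lifts poly_lifts_def smax_poly_signed_def)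

context
  fixes v :: "'a::linordered_field \<Rightarrow> 'g::linordered_ab_group_add option"
  assumes v: "convex_valuation v"
begin

private lemma val_eq_None_iff [simp]: "v x = None \<longleftrightarrow> x = 0"
  using v by (simp add: convex_valuation_def)

private lemma val_0 [simp]: "v 0 = None"
  by simp

private lemma val_mult: "v x = Some g \<Longrightarrow> v y = Some h \<Longrightarrow> v (x * y) = Some (g + h)"
  using v unfolding convex_valuation_def by (metis option.distinct(1) option.sel)

private lemma val_mult_le: "v x \<le> Some g \<Longrightarrow> v y \<le> Some h \<Longrightarrow> v (x * y) \<le> Some (g + h)"
  using val_mult by (cases "v x"; cases "v y") (auto intro: add_mono)

private lemma val_add_le: "v (x + y) \<le> max (v x) (v y)"
proof (cases "x = 0 \<or> y = 0 \<or> x + y = 0")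
  case False
  then have "the (v (x + y)) \<le> max (the (v x)) (the (v y))"
    using v unfolding convex_valuation_def by blast
  then show ?thesis
    using False by (cases "v x"; cases "v y"; cases "v (x + y)") (auto simp: max_def split: if_splits)
qed auto

private lemma val_mono: "\<bar>x\<bar> \<le> \<bar>y\<bar> \<Longrightarrow> v x \<le> v y"
proof (cases "x = 0")
  case False
  moreover assume "\<bar>x\<bar> \<le> \<bar>y\<bar>"
  ultimately have "y \<noteq> 0" "the (v x) \<le> the (v y)"
    using v unfolding convex_valuation_def by auto
  then show ?thesis using False by (cases "v x"; cases "v y") auto
qed simp

private lemma val_uminus [simp]: "v (- x) = v x"
  by (intro order.antisym val_mono) simp_all

private lemma val_1 [simp]: "v 1 = Some 0"
  using val_mult[of 1 _ 1] by (cases "v 1") auto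

private lemma val_add_dominated:
  assumes "v y < v x"
  shows "\<bar>y\<bar> < \<bar>x\<bar>" and "v (x + y) = v x"
proof -
  show "\<bar>y\<bar> < \<bar>x\<bar>" using assms val_mono[of x y] by (meson leD leI)
  have "v x \<le> max (v (x + y)) (v y)" using val_add_le[of "x + y" "- y"] by simp
  then show "v (x + y) = v x"
    using assms val_add_le[of x y] by (auto simp: max_def split: if_splits)
qed

private lemma val_add_same_sign:
  assumes "0 < x \<and> 0 < y \<or> x < 0 \<and> y < 0" "v x = v y"
  shows "v (x + y) = v x"
  using assms val_add_le[of x y] val_mono[of x "x + y"] by (intro order.antisym) auto

lemma lifts_signed_val: "lifts v x (signed_val v x)"
  by (auto simp: signed_val_def)

lemma val_le_modulus_if_lifts: "lifts v x s \<Longrightarrow> v x \<le> modulus s"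
  by (cases s) auto

lemma lifts_add_dominated:
  assumes "lifts v x s" "v y < modulus s"
  shows "lifts v (x + y) s"
proof (cases s)
  case (SBal g)
  then show ?thesis using assms val_add_le[of x y] by (auto simp: max_def split: if_splits)
qed (use assms val_add_dominated[of y x] in auto)

lemma lifts_add_same_modulus:
  assumes "lifts v x s" "lifts v y t" "modulus s = modulus t"
  shows "lifts v (x + y) (s + t)"
proof (cases "s = t")
  case True
  then have "s + t = s" by (cases s) (auto simp: smax_ops)
  then show ?thesis
    using assms True val_add_same_sign[of x y] val_add_le[of x y]
    by (cases s) (auto simp: max_def split: if_splits)
next
  case False
  then obtain g where "s + t = SBal g" "modulus s = Some g"
    using assms(3) by (cases s; cases t) (auto simp: smax_ops)
  then show ?thesis
    using assms val_le_modulus_if_lifts[of x s] val_le_modulus_if_lifts[of y t]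
      val_add_le[of x y]
    by (auto simp: max_def split: if_splits)
qed

lemma lifts_add:
  assumes "lifts v x s" "lifts v y t"
  shows "lifts v (x + y) (s + t)"
proof (cases "modulus s" "modulus t" rule: linorder_cases)
  case less
  then have "v x < modulus t" using val_le_modulus_if_lifts[OF assms(1)] by order
  then have "lifts v (y + x) t" by (rule lifts_add_dominated[OF assms(2)])
  then show ?thesis using add_absorb[OF less] by (simp add: add.commute)
next
  case equal
  then show ?thesis by (rule lifts_add_same_modulus[OF assms])
next
  case greater
  then have "v y < modulus s" using val_le_modulus_if_lifts[OF assms(2)] by order
  then have "lifts v (x + y) s" by (rule lifts_add_dominated[OF assms(1)])
  then show ?thesis using add_absorb[OF greater] by simp
qed

lemma lifts_mult:
  assumes "lifts v x s" "lifts v y t"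
  shows "lifts v (x * y) (s * t)"
  using assms
  by (cases s; cases t)
    (auto simp: times_smax_def mult_pos_neg mult_neg_pos mult_neg_neg intro: val_mult val_mult_le)

lemma lifts_uminus: "lifts v x s \<Longrightarrow> lifts v (- x) (smax_neg s)"
  by (cases s) auto

lemma lifts_0: "lifts v 0 0" and lifts_1: "lifts v 1 1"
  by (auto simp: smax_ops)

lemma lifts_sum: "(\<And>i. i \<in> S \<Longrightarrow> lifts v (f i) (F i)) \<Longrightarrow> lifts v (sum f S) (sum F S)"
  by (induction S rule: infinite_finite_induct) (auto intro: lifts_add lifts_0)

lemma poly_lifts_add: "poly_lifts v p P \<Longrightarrow> poly_lifts v q Q \<Longrightarrow> poly_lifts v (p + q) (P + Q)"
  by (auto simp: poly_lifts_def intro: lifts_add)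

lemma poly_lifts_mult: "poly_lifts v p P \<Longrightarrow> poly_lifts v q Q \<Longrightarrow> poly_lifts v (p * q) (P * Q)"
  by (auto simp: poly_lifts_def coeff_mult intro!: lifts_sum lifts_mult)

lemma poly_lifts_0: "poly_lifts v 0 0"
  by (simp add: poly_lifts_def lifts_0)

lemma poly_lifts_pCons: "lifts v a s \<Longrightarrow> poly_lifts v p P \<Longrightarrow> poly_lifts v (pCons a p) (pCons s P)"
  by (auto simp: poly_lifts_def coeff_pCons split: nat.split)

lemma poly_lifts_1: "poly_lifts v 1 1"
  unfolding one_pCons by (intro poly_lifts_pCons lifts_1 poly_lifts_0)

lemma poly_lifts_sum: "(\<And>i. i \<in> S \<Longrightarrow> poly_lifts v (f i) (F i)) \<Longrightarrow> poly_lifts v (sum f S) (sum F S)"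
  by (induction S rule: infinite_finite_induct) (auto intro: poly_lifts_add poly_lifts_0)

lemma poly_lifts_prod: "(\<And>i. i \<in> S \<Longrightarrow> poly_lifts v (f i) (F i)) \<Longrightarrow> poly_lifts v (prod f S) (prod F S)"
  by (induction S rule: infinite_finite_induct) (auto intro: poly_lifts_mult poly_lifts_1)

lemma poly_lifts_root_poly: "poly_lifts v (root_poly M) (smax_root_poly (image_mset (signed_val v) M))"
proof (induction M)
  case (add x M)
  have "poly_lifts v [:- x, 1:] [:smax_neg (signed_val v x), 1:]"
    by (intro poly_lifts_pCons lifts_uminus lifts_signed_val lifts_1 poly_lifts_0)
  with add show ?case by (auto intro: poly_lifts_mult simp del: mult_pCons_left)
qed (simp add: poly_lifts_1)

lemma poly_lifts_signof: "poly_lifts v (signof p) (if evenperm p then 1 else smax_poly_neg 1)"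
proof (cases "evenperm p")
  case True
  then show ?thesis by (simp add: sign_def poly_lifts_1)
next
  case False
  have "poly_lifts v [:- 1:] [:smax_neg 1:]"
    by (intro poly_lifts_pCons lifts_uminus lifts_1 poly_lifts_0)
  then show ?thesis using False by (simp add: sign_def smax_poly_neg_def one_pCons)
qed

lemma poly_lifts_char_poly_matrix:
  assumes "A \<in> carrier_mat n n" "i < n" "j < n"
  shows "poly_lifts v (char_poly_matrix A $$ (i, j))
    ((if i = j then [:0, 1:] else 0) + [:smax_neg (map_mat (signed_val v) A $$ (i, j)):])"
proof -
  have "char_poly_matrix A $$ (i, j) = (if i = j then [:0, 1:] else 0) + [:- (A $$ (i, j)):]"
    using assms by (simp add: char_poly_matrix_def)
  moreover have "poly_lifts v (if i = j then [:0, 1:] else 0) (if i = j then [:0, 1:] else 0)"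
    by (auto intro!: poly_lifts_pCons lifts_0 lifts_1 poly_lifts_0)
  moreover have "poly_lifts v [:- (A $$ (i, j)):] [:smax_neg (map_mat (signed_val v) A $$ (i, j)):]"
    using assms by (auto intro!: poly_lifts_pCons lifts_uminus lifts_signed_val poly_lifts_0)
  ultimately show ?thesis by (simp only: poly_lifts_add)
qed

lemma poly_lifts_char_poly:
  assumes A: "A \<in> carrier_mat n n"
  shows "poly_lifts v (char_poly A) (smax_char_poly (map_mat (signed_val v) A))"
proof -
  have "char_poly A = (\<Sum>p\<in>{p. p permutes {..<n}}. signof p * (\<Prod>i<n. char_poly_matrix A $$ (i, p i)))"
    unfolding char_poly_def using A by (subst det_def'[of _ n]) (auto simp: atLeast0LessThan)
  moreover have "dim_row (map_mat (signed_val v) A) = n" using A by simp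
  ultimately show ?thesis
    unfolding smax_char_poly_def sym_det_def
    using permutes_in_image[of _ "{..<n}"]
    by (auto intro!: poly_lifts_sum poly_lifts_mult poly_lifts_signof poly_lifts_prod
      poly_lifts_char_poly_matrix[OF A] simp del: index_map_mat)
qed

end

theorem theorem6p3:
  fixes v :: "'a::linordered_field \<Rightarrow> 'g::linordered_ab_group_add option"
    and A :: "'g smax mat" and AA :: "'a mat" and n :: nat
  assumes "divisible_group TYPE('g)"
    and "real_closed_field TYPE('a)"
    and "convex_valuation v"
    and "smax_TPD n A"
    and "pos_def_mat n AA"
    and "map_mat (signed_val v) AA = A"
  shows "\<forall>\<gamma>. count (image_mset (signed_val v) (proots (char_poly AA))) \<gamma> = smax_alg_eig_mult A \<gamma>
       \<and> count (image_mset (signed_val v) (proots (char_poly AA))) \<gamma>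
           = count (mset (map (\<lambda>i. A $$ (i, i)) [0..<n])) \<gamma>"
proof -
  have AA: "AA \<in> carrier_mat n n" "AA\<^sup>T = AA" using assms(5) by (auto simp: pos_def_mat_def)
  define D where "D = mset (map (\<lambda>i. A $$ (i, i)) [0..<n])"
  have char_A: "smax_char_poly A = smax_root_poly D"
    unfolding D_def by (rule smax_TPD_char_poly[OF assms(4)])
  have D_pos: "\<forall>d\<in>#D. smax_less 0 d"
    using smax_TPD_diag_pos[OF assms(4)] by (auto simp: D_def)
  obtain M where M: "char_poly AA = root_poly M"
    using symmetric_char_poly_splits[OF assms(2) AA] .
  define E where "E = image_mset (signed_val v) M"
  have E_pos: "\<forall>d\<in>#E. smax_less 0 d"
    using pos_def_mat_root_pos[OF assms(5)] by (auto simp: E_def M signed_val_def smax_less_0_iff)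
  have "poly_lifts v (char_poly AA) (smax_root_poly E)"
    unfolding M E_def by (rule poly_lifts_root_poly[OF assms(3)])
  moreover have "poly_lifts v (char_poly AA) (smax_root_poly D)"
    using poly_lifts_char_poly[OF assms(3) AA(1)] by (simp only: assms(6) char_A)
  ultimately have "smax_root_poly E = smax_root_poly D"
    using smax_root_poly_signed E_pos D_pos by (blast intro: poly_lifts_signed_unique)
  then have "E = D" by (rule smax_root_poly_inject[OF E_pos D_pos])
  then show ?thesis
    unfolding D_def[symmetric] by (simp add: M E_def smax_alg_eig_mult_root_poly[OF char_A D_pos])
qed

end
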